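(* Let $\Lambda=[-1,1]$ and let $r>1$. Let $q_{N_b,\eta}=Q_{N_b,\eta}^{(T,R)}g$ be the local weighted GTSVD reconstruction of a function $g$ on $\Lambda$, and suppose that the reconstruction error $e_{N_b,\eta}=g-q_{N_b,\eta}$ satisfies $$\|e_{N_b,\eta}\|_{L^2(\Lambda)}\le \varepsilon_{N_b,\eta},\qquad \|e_{N_b,\eta}\|_{H^r(\Lambda)}\le M_r .$$ Then $$\|g'-q_{N_b,\eta}'\|_{L^2(\Lambda)}\le C_r\,M_r^{1/r}\,\varepsilon_{N_b,\eta}^{(r-1)/r},$$ where $C_r$ is independent of $\varepsilon_{N_b,\eta}$.
   Context: Local weighted GTSVD reconstruction. Let $T>1$, let $N_b$ be the number of local modes, $m$ the number of local samples, $\eta>0$ a truncation threshold, and $R=\operatorname{diag}(r_0,\dots,r_{N_b-1})$ a diagonal weight matrix with positive entries (for example $r_j=e^{\beta j}$, $\beta\ge0$). Let $\{p_j\}_{j\ge0}$ be the orthonormal Legendre polynomials on $[-1,1]$ and $P_j^{(T)}(t)=T^{-1/2}p_j(t/T)$, which are orthonormal in $L^2([-T,T])$ but are used only on $\Lambda=[-1,1]$. Let $t_l=-1+\frac{2l}{m-1}$, $l=0,\dots,m-1$, be equispaced nodes and let $A\in\mathbb R^{m\times N_b}$ have entries $A_{lj}=m^{-1/2}P_j^{(T)}(t_l)$. Let $AR^{-1}=U\Sigma V^T$ be a singular value decomposition with singular values $\tau_i$ and left/right singular vectors $u_i,v_i$. For $g$ on $\Lambda$ with data vector $\mathbf g=(g(t_0),\dots,g(t_{m-1}))^T$,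 set $$\mathbf c=R^{-1}\sum_{\tau_i>\eta}\frac{\langle m^{-1/2}\mathbf g,u_i\rangle}{\tau_i}v_i,\qquad Q_{N_b,\eta}^{(T,R)}g=\sum_{j=0}^{N_b-1}c_jP_j^{(T)}|_\Lambda .$$ $H^r(\Lambda)$ is the $L^2$-based Sobolev space of order $r$ on $\Lambda$. *)

theory Defs
  imports "HOL-Analysis.Analysis" "HOL-Computational_Algebra.Polynomial"
    "Jordan_Normal_Form.Matrix"
begin

unbundle no vec_syntax
unbundle no inner_syntax
hide_const (open) Finite_Cartesian_Product.vec Finite_Cartesian_Product.mat

section \<open>Sobolev spaces on the interval [-1,1]\<close>

abbreviation Lam :: "real set" where "Lam \<equiv> {-1..1}"

definition square_integrable :: "(real \<Rightarrow> real) \<Rightarrow> bool" where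
  "square_integrable u \<longleftrightarrow>
     u \<in> borel_measurable (lebesgue_on Lam) \<and> integrable (lebesgue_on Lam) (\<lambda>x. (u x)\<^sup>2)"

text \<open>Meaningful for square integrable functions only: a Bochner integral that does not exist is 0.\<close>

definition L2_norm :: "(real \<Rightarrow> real) \<Rightarrow> real" where
  "L2_norm u = sqrt (LINT x|lebesgue_on Lam. (u x)\<^sup>2)"

definition test_function :: "(real \<Rightarrow> real) \<Rightarrow> bool" where
  "test_function \<phi> \<longleftrightarrow>
     (\<forall>n x. (deriv ^^ n) \<phi> differentiable (at x)) \<and>
     compact (closure {x. \<phi> x \<noteq> 0}) \<and> closure {x. \<phi> x \<noteq> 0} \<subseteq> interior Lam"

definition locally_integrable :: "(real \<Rightarrow> real) \<Rightarrow> bool" where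
  "locally_integrable u \<longleftrightarrow>
     (\<forall>K. compact K \<and> K \<subseteq> interior Lam \<longrightarrow> integrable (lebesgue_on K) u)"

definition is_weak_deriv :: "nat \<Rightarrow> (real \<Rightarrow> real) \<Rightarrow> (real \<Rightarrow> real) \<Rightarrow> bool" where
  "is_weak_deriv k u v \<longleftrightarrow> locally_integrable u \<and> locally_integrable v \<and>
     (\<forall>\<phi>. test_function \<phi> \<longrightarrow>
        (LINT x|lebesgue_on Lam. u x * (deriv ^^ k) \<phi> x)
          = (-1) ^ k * (LINT x|lebesgue_on Lam. v x * \<phi> x))"

text \<open>
  A chosen representative of the weak derivative, which is unique almost everywhere on [-1,1]
  when it exists. All uses are insensitive to the choice, and existence is always stated
  separately through the predicate above.
\<close>

definition weak_deriv :: "nat \<Rightarrow> (real \<Rightarrow> real) \<Rightarrow> real \<Rightarrow> real" where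
  "weak_deriv k u = (SOME v. is_weak_deriv k u v)"

text \<open>
  For real order r the space is the Sobolev--Slobodeckij space: with r = k + s, where k is the
  integer part, weak derivatives up to order k lie in L2 and, if s > 0, the k-th one has
  finite Gagliardo seminorm of order s. On the diagonal the quotient below is 0 / 0 = 0.
\<close>

definition gagliardo_quot :: "real \<Rightarrow> (real \<Rightarrow> real) \<Rightarrow> real \<times> real \<Rightarrow> real" where
  "gagliardo_quot s v = (\<lambda>(x, y). (v x - v y)\<^sup>2 / \<bar>x - y\<bar> powr (1 + 2 * s))"

definition in_sobolev :: "real \<Rightarrow> (real \<Rightarrow> real) \<Rightarrow> bool" where
  "in_sobolev r u \<longleftrightarrow>
     (\<forall>j \<le> nat \<lfloor>r\<rfloor>. is_weak_deriv j u (weak_deriv j u) \<and> square_integrable (weak_deriv j u)) \<and>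
     (frac r > 0 \<longrightarrow>
        integrable (lebesgue_on Lam \<Otimes>\<^sub>M lebesgue_on Lam)
          (gagliardo_quot (frac r) (weak_deriv (nat \<lfloor>r\<rfloor>) u)))"

definition sobolev_norm :: "real \<Rightarrow> (real \<Rightarrow> real) \<Rightarrow> real" where
  "sobolev_norm r u = sqrt
     ((\<Sum>j\<le>nat \<lfloor>r\<rfloor>. (L2_norm (weak_deriv j u))\<^sup>2) +
      (if frac r > 0
       then LINT z|(lebesgue_on Lam \<Otimes>\<^sub>M lebesgue_on Lam).
              gagliardo_quot (frac r) (weak_deriv (nat \<lfloor>r\<rfloor>) u) z
       else 0))"

section \<open>Local weighted GTSVD reconstruction\<close>

text \<open>
  Orthonormal Legendre polynomials on [-1,1] by Rodrigues' formula; the square root turns the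
  classical normalisation (value 1 at 1) into unit L2 norm.
\<close>

definition legendre_on :: "nat \<Rightarrow> real poly" where
  "legendre_on n =
     Polynomial.smult (sqrt ((2 * real n + 1) / 2) / (2 ^ n * fact n)) ((pderiv ^^ n) ([:-1, 0, 1:] ^ n))"

definition scaled_legendre :: "real \<Rightarrow> nat \<Rightarrow> real \<Rightarrow> real" where
  "scaled_legendre T j t = poly (legendre_on j) (t / T) / sqrt T"

definition node :: "nat \<Rightarrow> nat \<Rightarrow> real" where
  "node m l = -1 + 2 * real l / (real m - 1)"

definition sample_mat :: "real \<Rightarrow> nat \<Rightarrow> nat \<Rightarrow> real mat" where
  "sample_mat T m N = mat m N (\<lambda>(l, j). scaled_legendre T j (node m l) / sqrt (real m))"

definition data_vec :: "nat \<Rightarrow> (real \<Rightarrow> real) \<Rightarrow> real vec" where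
  "data_vec m g = vec m (\<lambda>l. g (node m l))"

text \<open>The inverse of the weight matrix R = diag (w 0, ..., w (N-1)).\<close>

definition weight_inv :: "nat \<Rightarrow> (nat \<Rightarrow> real) \<Rightarrow> real mat" where
  "weight_inv N w = mat_diag N (\<lambda>j. inverse (w j))"

lemma weight_inv_inverts:
  assumes "\<And>j. j < N \<Longrightarrow> w j > 0"
  shows "inverts_mat (mat_diag N w) (weight_inv N w)"
    and "inverts_mat (weight_inv N w) (mat_diag N w)"
proof -
  have *: "mat_diag N (\<lambda>j. w j * inverse (w j)) = 1\<^sub>m N"
    by (rule eq_matI) (use assms in \<open>auto simp: mat_diag_def, force\<close>)
  have dim: "dim_row (mat_diag N f) = N" for f :: "nat \<Rightarrow> real"
    by (simp add: mat_diag_def)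
  show "inverts_mat (mat_diag N w) (weight_inv N w)"
    using * by (simp add: inverts_mat_def weight_inv_def dim)
  show "inverts_mat (weight_inv N w) (mat_diag N w)"
    using * by (simp add: inverts_mat_def weight_inv_def dim mult.commute)
qed

text \<open>
  Full singular value decomposition. The singular values are the entries S(i,i) with
  i < min m n; they need not be listed in decreasing order. The library's orthogonal_mat only
  makes the columns pairwise orthogonal, hence the explicit normalisation.
\<close>

definition is_svd :: "real mat \<Rightarrow> real mat \<Rightarrow> real mat \<Rightarrow> real mat \<Rightarrow> bool" where
  "is_svd B U S V \<longleftrightarrow>
     (let m = dim_row B; n = dim_col B in
      U \<in> carrier_mat m m \<and> U\<^sup>T * U = 1\<^sub>m m \<and>
      V \<in> carrier_mat n n \<and> V\<^sup>T * V = 1\<^sub>m n \<and>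
      S \<in> carrier_mat m n \<and> diagonal_mat S \<and> (\<forall>i < min m n. S $$ (i, i) \<ge> 0) \<and>
      B = U * S * V\<^sup>T)"

definition gtsvd_coeffs ::
  "nat \<Rightarrow> nat \<Rightarrow> real \<Rightarrow> (nat \<Rightarrow> real) \<Rightarrow> real mat \<Rightarrow> real mat \<Rightarrow> real mat \<Rightarrow> (real \<Rightarrow> real) \<Rightarrow> real vec" where
  "gtsvd_coeffs m N \<eta> w U S V g =
     weight_inv N w *\<^sub>v
       vec N (\<lambda>k. \<Sum>i | i < min m N \<and> S $$ (i, i) > \<eta>.
         (((1 / sqrt (real m)) \<cdot>\<^sub>v data_vec m g) \<bullet> col U i) / S $$ (i, i) * (col V i $ k))"

definition gtsvd_recon ::
  "real \<Rightarrow> nat \<Rightarrow> nat \<Rightarrow> real \<Rightarrow> (nat \<Rightarrow> real) \<Rightarrow> real mat \<Rightarrow> real mat \<Rightarrow> real mat \<Rightarrow> (real \<Rightarrow> real) \<Rightarrow> real \<Rightarrow> real" where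
  "gtsvd_recon T m N \<eta> w U S V g x =
     (\<Sum>j<N. gtsvd_coeffs m N \<eta> w U S V g $ j * scaled_legendre T j x)"

end

(*
  Only the error e = g - q matters: q is a polynomial, so g' = e' + q' in the weak sense.

  Cut [-1,1] into intervals I of length h and let psi be a bump of unit mass supported in I. For x
  in I the derivative v = e' satisfies
    v(x) = int_I v psi + int_I (v(x) - v(y)) psi(y) dy.
  The first term equals - int_I e psi', which costs a factor 1/h, and the second is controlled by
  the double integral of (v(x) - v(y))^2 over I x I, hence by h^s times the Gagliardo seminorm of
  v or by h times the L2 norm of v'. Summing over I gives
    ||e'|| <= C (||e|| / h + h^(r-1) |e|_r)   for 0 < h <= 1
  if 1 < r <= 2. Larger r follow by induction on the integer part of r, applying the case r - 1 to
  e' and the case 2 to e. The theorem is the choice h = (eps / M)^(1/r).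
*)
theory Submission
  imports Defs
begin

section \<open>Smooth functions and test functions\<close>

text \<open>The estimates use neither approximation by smooth functions nor an extension beyond
  [-1,1]: the weak derivative is tested with rescaled copies of one bump, so the constant does not
  depend on the position or length of an interval. Most of the remaining work lies around this. The
  functions \<open>weak_deriv j e\<close> are arbitrary representatives, so identities between them
  hold only almost everywhere and rest on uniqueness, that is on the fundamental lemma. For order 2
  the increments v(x) - v(y) have to be bounded through v', which requires v to agree almost
  everywhere with a primitive of v'; this is what the du Bois-Reymond lemma is for. Finally, h is
  restricted to (0,1], whereas (eps / M)^(1/r) may exceed 1 or degenerate to 0: for eps > M the
  trivial bound ||e'|| <= M takes over, and for eps = 0 < M a sufficiently small h is used.\<close>

definition smooth :: "(real \<Rightarrow> real) \<Rightarrow> bool" where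
  "smooth f \<longleftrightarrow> (\<forall>n x. (deriv ^^ n) f differentiable (at x))"

text \<open>Differentiability of finite order, set up for induction: the recursion differentiates
  \<open>f\<close> first, so with \<open>f\<close> and \<open>g\<close> arbitrary in the induction
  hypothesis the sum and product rules can be applied to their derivatives.\<close>

primrec times_differentiable :: "nat \<Rightarrow> (real \<Rightarrow> real) \<Rightarrow> bool" where
  "times_differentiable 0 f \<longleftrightarrow> True"
| "times_differentiable (Suc n) f \<longleftrightarrow>
     (\<forall>x. f differentiable (at x)) \<and> times_differentiable n (deriv f)"

lemma times_differentiable_iff:
  "times_differentiable n f \<longleftrightarrow> (\<forall>k<n. \<forall>x. (deriv ^^ k) f differentiable (at x))"
proof (induction n arbitrary: f)
  case (Suc n)
  show ?case
    by (simp add: Suc All_less_Suc2 funpow_swap1)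
qed simp

lemma smooth_iff: "smooth f \<longleftrightarrow> (\<forall>n. times_differentiable n f)"
  unfolding smooth_def times_differentiable_iff by blast

lemma smooth_differentiable: "smooth f \<Longrightarrow> f differentiable (at x)"
  unfolding smooth_def by (metis funpow_0)

lemma smooth_has_deriv: "smooth f \<Longrightarrow> (f has_real_derivative deriv f x) (at x)"
  using smooth_differentiable DERIV_deriv_iff_real_differentiable by blast

lemma smooth_deriv: "smooth f \<Longrightarrow> smooth (deriv f)"
  unfolding smooth_def using funpow_swap1 [of deriv] by (metis comp_apply funpow.simps(2))

lemma smooth_continuous_on: "smooth f \<Longrightarrow> continuous_on S f"
  by (meson smooth_has_deriv DERIV_continuous_on DERIV_subset subset_UNIV)

lemma smooth_from_deriv:
  assumes "\<And>x. (f has_real_derivative f' x) (at x)" "smooth f'"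
  shows "smooth f"
proof -
  have "deriv f = f'" using assms(1) by (auto intro!: DERIV_imp_deriv)
  moreover have "f differentiable (at x)" for x
    using assms(1) real_differentiable_def by blast
  ultimately have "times_differentiable n f" for n
    using assms(2) by (cases n) (auto simp: smooth_iff)
  thus ?thesis by (simp add: smooth_iff)
qed

text \<open>For functions whose derivatives keep changing shape but stay inside one family, such as
  \<open>flat\<close> below. The induction on the order works because it treats all members of
  \<open>F\<close> at once.\<close>

lemma smooth_coinduct:
  assumes "f \<in> F" "\<And>f. f \<in> F \<Longrightarrow> \<exists>g\<in>F. \<forall>x. (f has_real_derivative g x) (at x)"
  shows "smooth f"
proof -
  have "\<forall>f\<in>F. times_differentiable n f" for n
  proof (induction n)
    case (Suc n)
    show ?case
    proof
      fix f assume "f \<in> F"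
      then obtain g where g: "g \<in> F" "\<And>x. (f has_real_derivative g x) (at x)" using assms(2) by blast
      hence "deriv f = g" by (auto intro!: DERIV_imp_deriv)
      thus "times_differentiable (Suc n) f" using g Suc real_differentiable_def by auto
    qed
  qed simp
  thus ?thesis using assms(1) by (simp add: smooth_iff)
qed

lemma times_differentiable_SucD: "times_differentiable (Suc n) f \<Longrightarrow> times_differentiable n f"
  by (simp add: times_differentiable_iff)

lemma times_differentiable_add:
  "times_differentiable n f \<Longrightarrow> times_differentiable n g \<Longrightarrow> times_differentiable n (\<lambda>x. f x + g x)"
proof (induction n arbitrary: f g)
  case (Suc n)
  have "deriv (\<lambda>x. f x + g x) = (\<lambda>x. deriv f x + deriv g x)"
    using Suc.prems by (auto intro!: deriv_add simp: field_differentiable_def real_differentiable_def)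
  thus ?case using Suc by auto
qed simp

lemma times_differentiable_mult:
  "times_differentiable n f \<Longrightarrow> times_differentiable n g \<Longrightarrow> times_differentiable n (\<lambda>x. f x * g x)"
proof (induction n arbitrary: f g)
  case (Suc n)
  have "deriv (\<lambda>x. f x * g x) = (\<lambda>x. f x * deriv g x + deriv f x * g x)"
    using Suc.prems by (auto intro!: deriv_mult simp: field_differentiable_def real_differentiable_def)
  moreover have "times_differentiable n f" "times_differentiable n g"
    using Suc.prems times_differentiable_SucD by blast+
  ultimately show ?case using Suc by (auto intro!: times_differentiable_add)
qed simp

lemma smooth_add: "smooth f \<Longrightarrow> smooth g \<Longrightarrow> smooth (\<lambda>x. f x + g x)"
  and smooth_mult: "smooth f \<Longrightarrow> smooth g \<Longrightarrow> smooth (\<lambda>x. f x * g x)"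
  by (simp_all add: smooth_iff times_differentiable_add times_differentiable_mult)

lemma smooth_const: "smooth (\<lambda>x. c)"
  by (rule smooth_coinduct [of _ "range (\<lambda>c x. c)"]) (auto intro!: derivative_eq_intros)

lemma smooth_cmult: "smooth f \<Longrightarrow> smooth (\<lambda>x. c * f x)"
  by (intro smooth_mult smooth_const)

lemma smooth_affine:
  assumes "smooth f"
  shows "smooth (\<lambda>x. f (c * x + d))"
proof (rule smooth_coinduct)
  \<comment> \<open>The factor \<open>k\<close> collects the powers of \<open>c\<close> that the
    chain rule produces, which closes the family under differentiation.\<close>
  show "(\<lambda>x. f (c * x + d)) \<in> {(\<lambda>x. k * h (c * x + d)) | k h. smooth h}"
    using assms by (auto intro!: exI [of _ 1] exI [of _ f])
next
  fix g assume "g \<in> {(\<lambda>x. k * h (c * x + d)) | k h. smooth h}"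
  then obtain k h where g: "g = (\<lambda>x. k * h (c * x + d))" and h: "smooth h" by auto
  have "((\<lambda>x. c * x + d) has_real_derivative c) (at x)" for x
    by (auto intro!: derivative_eq_intros)
  from DERIV_cmult [OF DERIV_chain2 [OF smooth_has_deriv [OF h] this], where c = k]
  have "(g has_real_derivative k * (deriv h (c * x + d) * c)) (at x)" for x
    unfolding g .
  thus "\<exists>g'\<in>{(\<lambda>x. k * h (c * x + d)) | k h. smooth h}. \<forall>x. (g has_real_derivative g' x) (at x)"
    using smooth_deriv [OF h]
    by (intro bexI [of _ "\<lambda>x. k * (deriv h (c * x + d) * c)"] CollectI exI [of _ "k * c"] exI [of _ "deriv h"])
      (auto simp: mult_ac)
qed

text \<open>
  The factor \<open>p\<close> makes this family closed under differentiation, so smoothness needs no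
  separate treatment of the higher derivatives at 0.
\<close>

definition flat :: "real poly \<Rightarrow> real \<Rightarrow> real" where
  "flat p x = (if x \<le> 0 then 0 else poly p (1 / x) * exp (- (1 / x)))"

text \<open>With y = 1/x this is the decay of p(y) / exp y as y tends to infinity.\<close>

lemma flat_tendsto_0: "((\<lambda>x. poly p (1 / x) * exp (- (1 / x))) \<longlongrightarrow> 0) (at_right 0)" for p :: "real poly"
proof -
  have "((\<lambda>x. poly p x / exp x) \<longlongrightarrow> 0) at_top"
  proof (induction p)
    case (pCons a p)
    have 0: "((\<lambda>x. a * (1 / exp x)) \<longlongrightarrow> a * 0) at_top"
      by (rule tendsto_mult [OF tendsto_const tendsto_divide_0 [OF tendsto_const filterlim_at_top_imp_at_infinity [OF exp_at_top]]])
    have 1: "((\<lambda>x::real. x ^ n / exp x) \<longlongrightarrow> 0) at_top" for n by (rule tendsto_power_div_exp_0)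
    have "((\<lambda>x. \<Sum>i\<le>degree p. coeff p i * (x ^ Suc i / exp x)) \<longlongrightarrow> (\<Sum>i\<le>degree p. coeff p i * 0)) at_top"
      by (intro tendsto_sum tendsto_mult tendsto_const 1)
    hence "((\<lambda>x. x * poly p x / exp x) \<longlongrightarrow> 0) at_top"
      by (simp add: poly_altdef sum_distrib_left sum_divide_distrib mult_ac)
    from tendsto_add [OF 0 this] show ?case by (simp add: add_divide_distrib)
  qed auto
  hence "((\<lambda>x. poly p (inverse x) / exp (inverse x)) \<longlongrightarrow> 0) (at_right 0)"
    by (rule filterlim_compose [OF _ filterlim_inverse_at_top_right])
  thus ?thesis by (simp only: exp_minus divide_inverse mult_1_left)
qed

text \<open>For x > 0 the chain rule gives (p - p')(1/x) * (1/x)^2 * exp(-1/x), and (1/x)^2 is the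
  value of \<open>monom 1 2\<close> at 1/x. At x = 0 the two one-sided difference quotients are
  computed.\<close>

lemma flat_has_deriv:
  "(flat p has_real_derivative flat (monom 1 2 * (p - pderiv p)) x) (at x)"
proof -
  consider "x < 0" | "x = 0" | "x > 0" by linarith
  thus ?thesis
  proof cases
    case 1
    have "((\<lambda>x. 0) has_real_derivative 0) (at x)" by simp
    moreover have "\<forall>\<^sub>F y in nhds x. flat p y = 0"
      using eventually_nhds_in_open [of "{..<0}" x] 1 by (auto elim!: eventually_mono simp: flat_def)
    moreover have "flat (monom 1 2 * (p - pderiv p)) x = 0" using 1 by (simp add: flat_def)
    ultimately show ?thesis
      by (simp add: DERIV_cong_ev [OF refl _ refl, of "flat p" "\<lambda>_. 0"])
  next
    case 3
    have d: "((\<lambda>x. 1 / x) has_real_derivative - (1 / x\<^sup>2)) (at x)"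
      using 3 by (auto intro!: derivative_eq_intros simp: power2_eq_square)
    have "((\<lambda>x. poly p (1 / x) * exp (- (1 / x))) has_real_derivative
            (poly (pderiv p) (1 / x) * - (1 / x\<^sup>2)) * exp (- (1 / x))
            + (exp (- (1 / x)) * - (- (1 / x\<^sup>2))) * poly p (1 / x)) (at x)"
      by (intro DERIV_mult DERIV_chain2 [OF poly_DERIV d] DERIV_chain2 [OF DERIV_exp DERIV_minus [OF d]])
    also have "(poly (pderiv p) (1 / x) * - (1 / x\<^sup>2)) * exp (- (1 / x))
            + (exp (- (1 / x)) * - (- (1 / x\<^sup>2))) * poly p (1 / x)
       = flat (monom 1 2 * (p - pderiv p)) x"
      using 3 by (simp add: flat_def poly_monom algebra_simps power_divide)
    finally have "((\<lambda>x. poly p (1 / x) * exp (- (1 / x))) has_real_derivative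
            flat (monom 1 2 * (p - pderiv p)) x) (at x)" .
    moreover have "\<forall>\<^sub>F y in nhds x. flat p y = poly p (1 / y) * exp (- (1 / y))"
      using eventually_nhds_in_open [of "{0<..}" x] 3 by (auto elim!: eventually_mono simp: flat_def)
    ultimately show ?thesis
      using DERIV_cong_ev [OF refl _ refl, of "flat p" "\<lambda>x. poly p (1 / x) * exp (- (1 / x))"] by blast
  next
    case 2
    have l: "((\<lambda>h. flat p h / h) \<longlongrightarrow> 0) (at_left 0)"
      by (rule tendsto_eventually) (auto simp: eventually_at_filter flat_def)
    have r: "((\<lambda>h. flat p h / h) \<longlongrightarrow> 0) (at_right 0)"
      \<comment> \<open>Division by h multiplies p(1/h) by 1/h, so the quotient has the same form
        again, with X * p in place of p.\<close>
      by (rule Lim_transform_eventually [OF flat_tendsto_0 [of "[:0, 1:] * p"]])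
         (auto simp: eventually_at_filter flat_def)
    have "((\<lambda>h. flat p h / h) \<longlongrightarrow> 0) (at 0)"
      using l r filterlim_split_at by blast
    thus ?thesis using 2 by (simp add: DERIV_def flat_def)
  qed
qed

lemma smooth_flat: "smooth (flat p)"
  by (rule smooth_coinduct [of _ "range flat"]) (auto intro!: flat_has_deriv)

section \<open>Test functions: supports, derivatives\<close>

lemma test_functionI:
  assumes "smooth \<phi>" "-1 < a" "b < 1" "\<And>x. x \<notin> {a..b} \<Longrightarrow> \<phi> x = 0"
  shows "test_function \<phi>"
proof -
  have sub: "closure {x. \<phi> x \<noteq> 0} \<subseteq> {a..b}"
    using assms(4) by (intro closure_minimal) blast+
  moreover have "compact (closure {x. \<phi> x \<noteq> 0})"
    using bounded_subset [OF compact_imp_bounded [OF compact_Icc] sub] compact_eq_bounded_closed by blast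
  moreover have "{a..b} \<subseteq> interior Lam"
    using assms by (auto simp: interior_atLeastAtMost_real)
  ultimately show ?thesis using assms(1) by (auto simp: test_function_def smooth_def)
qed

lemma test_function_smooth: "test_function \<phi> \<Longrightarrow> smooth \<phi>"
  by (simp add: test_function_def smooth_def)

lemma test_functionE:
  assumes "test_function \<phi>"
  obtains a b where "-1 < a" "a < b" "b < 1" "\<And>x. x \<notin> {a..b} \<Longrightarrow> \<phi> x = 0"
proof (cases "closure {x. \<phi> x \<noteq> 0} = {}")
  case True
  show ?thesis
    by (rule that [of 0 "1/2"]) (use True in auto)
next
  case False
  let ?K = "closure {x. \<phi> x \<noteq> 0}"
  have K: "compact ?K" "?K \<subseteq> {-1<..<1}"
    using assms by (auto simp: test_function_def interior_atLeastAtMost_real)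
  obtain a where a: "a \<in> ?K" "\<And>x. x \<in> ?K \<Longrightarrow> a \<le> x"
    using compact_attains_inf [OF K(1) False] by blast
  obtain b where b: "b \<in> ?K" "\<And>x. x \<in> ?K \<Longrightarrow> x \<le> b"
    using compact_attains_sup [OF K(1) False] by blast
  have "a \<in> {-1<..<1}" "b \<in> {-1<..<1}" "a \<le> b" using a b K(2) by blast+
  hence ab: "-1 < a" "a \<le> b" "b < 1" by auto
  show ?thesis
  \<comment> \<open>The right end is moved from \<open>b\<close> to the midpoint of \<open>b\<close>
    and 1, which makes the interval nondegenerate even if \<open>a = b\<close>.\<close>
  proof (rule that [of a "(b + 1) / 2"])
    fix x assume x: "x \<notin> {a..(b + 1) / 2}"
    have "x \<notin> ?K" using a(2) [of x] b(2) [of x] ab x by force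
    thus "\<phi> x = 0" using closure_subset [of "{x. \<phi> x \<noteq> 0}"] by auto
  qed (use ab in auto)
qed

lemma deriv_eq_0_outside:
  fixes \<phi> :: "real \<Rightarrow> real"
  assumes "\<And>x. x \<notin> {a..b} \<Longrightarrow> \<phi> x = 0" "x \<notin> {a..b}"
  shows "deriv \<phi> x = 0"
proof -
  have "\<forall>\<^sub>F y in nhds x. y \<in> - {a..b}"
    using assms(2) by (intro eventually_nhds_in_open) auto
  hence "\<forall>\<^sub>F y in nhds x. \<phi> y = 0" by eventually_elim (use assms(1) in auto)
  hence "deriv \<phi> x = deriv (\<lambda>_. 0) x" by (rule deriv_cong_ev) simp
  thus ?thesis by simp
qed

lemma test_function_deriv:
  assumes "test_function \<phi>" shows "test_function (deriv \<phi>)"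
proof -
  obtain a b where "-1 < a" "a < b" "b < 1" "\<And>x. x \<notin> {a..b} \<Longrightarrow> \<phi> x = 0"
    using test_functionE [OF assms] by metis
  thus ?thesis
    by (intro test_functionI [OF smooth_deriv [OF test_function_smooth [OF assms]], of a b] deriv_eq_0_outside)
qed

lemma test_function_deriv_funpow: "test_function \<phi> \<Longrightarrow> test_function ((deriv ^^ n) \<phi>)"
  by (induction n) (auto simp: test_function_deriv)

lemma test_function_continuous: "test_function \<phi> \<Longrightarrow> continuous_on S \<phi>"
  by (intro smooth_continuous_on test_function_smooth)

section \<open>Bump functions approximating indicators\<close>

text \<open>For n > 0 this is exp(-1/(n(x-a))) * exp(-1/(n(b-x))) on (a,b) and 0 elsewhere. The
  parameter \<open>n\<close> steepens the flanks: as it grows, the values inside tend to 1. The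
  arguments are written in expanded form to match \<open>smooth_affine\<close>.\<close>

definition bump :: "real \<Rightarrow> real \<Rightarrow> real \<Rightarrow> real \<Rightarrow> real" where
  "bump n a b x = flat 1 (n * x + (- (n * a))) * flat 1 ((- n) * x + n * b)"

lemma smooth_bump: "smooth (bump n a b)"
  unfolding bump_def by (intro smooth_mult smooth_affine smooth_flat)

lemma flat1_bounds: "0 \<le> flat 1 x" "flat 1 x \<le> 1"
  by (auto simp: flat_def)

lemma bump_bounds: "0 \<le> bump n a b x" "bump n a b x \<le> 1"
  unfolding bump_def using flat1_bounds by (auto intro: mult_le_one)

lemma bump_outside:
  assumes "n > 0" "x \<notin> {a<..<b}" shows "bump n a b x = 0"
proof -
  have "n * x + (- (n * a)) \<le> 0 \<or> (- n) * x + n * b \<le> 0"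
    using assms by (auto simp: not_less)
  thus ?thesis by (auto simp: bump_def flat_def)
qed

lemma bump_pos:
  assumes "n > 0" "x \<in> {a<..<b}" shows "bump n a b x > 0"
  using assms by (auto simp: bump_def flat_def)

lemma test_function_bump: "n > 0 \<Longrightarrow> -1 < a \<Longrightarrow> b < 1 \<Longrightarrow> test_function (bump n a b)"
  by (rule test_functionI [OF smooth_bump, of a b]) (auto intro!: bump_outside)

lemma bump_tendsto_indicator:
  "(\<lambda>n. bump (real (Suc n)) a b x) \<longlonglongrightarrow> indicator {a<..<b} x"
proof (cases "x \<in> {a<..<b}")
  case False
  thus ?thesis by (simp add: bump_outside)
next
  case True
  have *: "(\<lambda>n. exp (- (1 / (real (Suc n) * d)))) \<longlonglongrightarrow> 1" if "d > 0" for d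
  proof -
    have "(\<lambda>n. exp (- ((1 / d) * inverse (real (Suc n))))) \<longlonglongrightarrow> exp (- ((1 / d) * 0))"
      by (intro tendsto_exp tendsto_minus tendsto_mult tendsto_const LIMSEQ_inverse_real_of_nat)
    thus ?thesis by (simp add: field_simps del: of_nat_Suc)
  qed
  have "bump (real (Suc n)) a b x =
        exp (- (1 / (real (Suc n) * (x - a)))) * exp (- (1 / (real (Suc n) * (b - x))))" for n
  proof -
    have eq: "c * x + - (c * a) = c * (x - a)" "- c * x + c * b = c * (b - x)" for c
      by (simp_all add: algebra_simps)
    have "real (Suc n) * (x - a) > 0" "real (Suc n) * (b - x) > 0"
      using True by (auto intro!: mult_pos_pos simp del: of_nat_Suc)
    thus ?thesis unfolding bump_def eq by (simp add: flat_def del: of_nat_Suc)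
  qed
  thus ?thesis using tendsto_mult [OF * *, of "x - a" "b - x"] True by simp
qed

section \<open>The fundamental lemma of the calculus of variations\<close>

text \<open>Half-open intervals form an intersection-stable generator of the Borel sets, and the
  sets over which the integral vanishes are closed under complements and countable disjoint unions.
  So the integral vanishes over every Borel set, which forces the function to be 0 almost
  everywhere. The generator only reaches Borel sets, hence the passage to a Borel measurable
  representative \<open>g\<close>.\<close>

lemma AE_zero_if_interval_integrals_zero:
  fixes f :: "real \<Rightarrow> real"
  assumes f: "integrable lebesgue f"
    and z: "\<And>a b. (LINT x|lebesgue. indicator {a<..b} x * f x) = 0"
  shows "AE x in lebesgue. f x = 0"
proof -
  obtain g where g [measurable]: "g \<in> borel_measurable lborel" and fg: "AE x in lborel. f x = g x"
    using completion_ex_borel_measurable_real [OF borel_measurable_integrable [OF f]] by blast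
  have fg': "AE x in lebesgue. f x = g x" using fg by (rule AE_completion)
  have g_meas: "g \<in> borel_measurable lebesgue" using g by (rule measurable_completion)
  have "integrable lebesgue g"
    using integrable_cong_AE [OF borel_measurable_integrable [OF f] g_meas fg'] f by simp
  hence gi: "integrable lborel g" using integrable_completion [OF g] by simp
  have gi': "integrable lborel (\<lambda>x. indicator A x * g x)" if "A \<in> sets borel" for A
    using integrable_mult_indicator [of A lborel g] gi that by simp
  let ?I = "\<lambda>A. LINT x|lborel. indicator A x * g x"
  have ivl: "?I {a<..b} = 0" for a b
  proof -
    have "(LINT x|lebesgue. indicator {a<..b} x * f x) = (LINT x|lebesgue. indicator {a<..b} x * g x)"
      using fg' by (intro integral_cong_AE borel_measurable_times borel_measurable_indicator g_meas borel_measurable_integrable [OF f]) auto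
    also have "\<dots> = ?I {a<..b}" by (rule integral_completion) simp
    finally show ?thesis using z by simp
  qed
  \<comment> \<open>Needed for the complement step of the induction below, which writes the integral
    over a complement as a difference from the whole line.\<close>
  have all: "?I UNIV = 0"
  proof -
    have "(\<lambda>n. ?I {- real n<..real n}) \<longlonglongrightarrow> ?I UNIV"
    proof (rule integral_dominated_convergence)
      show "integrable lborel (\<lambda>x. \<bar>g x\<bar>)" using gi by simp
      show "AE x in lborel. (\<lambda>n. indicator {- real n<..real n} x * g x) \<longlonglongrightarrow> indicator UNIV x * g x"
      proof (rule AE_I2)
        fix x :: real
        have "\<forall>\<^sub>F n in sequentially. \<bar>x\<bar> < real n"
          by (rule eventually_sequentiallyI [of "nat \<lfloor>\<bar>x\<bar>\<rfloor> + 1"]) linarith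
        thus "(\<lambda>n. indicator {- real n<..real n} x * g x) \<longlonglongrightarrow> indicator UNIV x * g x"
          by (intro tendsto_eventually, eventually_elim) (auto simp: indicator_def)
      qed
    qed (auto simp: indicator_def)
    thus ?thesis by (simp add: ivl LIMSEQ_const_iff)
  qed
  have zero: "?I A = 0" if "A \<in> sets borel" for A
  proof -
    have "Int_stable (range (\<lambda>(a, b). {a<..b::real}))"
      by (auto simp: Int_stable_def Int_greaterThanAtMost)
    moreover have "range (\<lambda>(a, b). {a<..b::real}) \<subseteq> Pow UNIV" by simp
    moreover have "A \<in> sigma_sets UNIV (range (\<lambda>(a, b). {a<..b::real}))"
      using that by (subst (asm) borel_sigma_sets_Ioc) simp
    ultimately show ?thesis
    proof (induction rule: sigma_sets_induct_disjoint)
      case (compl A)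
      have "A \<in> sets borel" using compl(1) by (subst borel_sigma_sets_Ioc) simp
      have "?I (UNIV - A) = (LINT x|lborel. indicator UNIV x * g x - indicator A x * g x)"
        by (intro Bochner_Integration.integral_cong) (auto simp: indicator_def)
      also have "\<dots> = ?I UNIV - ?I A"
        using \<open>A \<in> sets borel\<close> by (intro Bochner_Integration.integral_diff gi') auto
      finally have "?I (UNIV - A) = ?I UNIV - ?I A" .
      thus ?case using all compl by simp
    next
      case (union A)
      have A: "A i \<in> sets borel" for i using union(2) by (subst borel_sigma_sets_Ioc) auto
      have "(LINT x:(\<Union>i. A i)|lborel. g x) = (\<Sum>i. (LINT x:(A i)|lborel. g x))"
        using A union(1) gi'
        by (intro lebesgue_integral_countable_add) (auto simp: disjoint_family_on_def set_integrable_def)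
      thus ?case using union by (simp add: set_lebesgue_integral_def)
    qed (auto simp: ivl)
  qed
  have "AE x in lborel. g x = 0"
    using gi by (rule density_unique_real) (auto simp: set_lebesgue_integral_def zero)
  hence "AE x in lborel. f x = 0" using fg by eventually_elim simp
  thus ?thesis by (rule AE_completion)
qed

section \<open>Local integrability and products with test functions\<close>

lemma locally_integrable_ivl:
  assumes "locally_integrable f" "-1 < a" "b < 1"
  shows "integrable lebesgue (\<lambda>x. indicator {a..b} x * f x)"
proof -
  have "integrable (lebesgue_on {a..b}) f"
    using assms unfolding locally_integrable_def interior_atLeastAtMost_real
    by (elim allE [of _ "{a..b}"]) auto
  thus ?thesis by (subst (asm) integrable_restrict_space) auto
qed

lemma integrable_lebesgue_on_if:
  fixes f :: "real \<Rightarrow> real"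
  assumes "integrable lebesgue f" "S \<in> sets lebesgue"
  shows "integrable (lebesgue_on S) f"
  using assms integrable_mult_indicator [of S lebesgue f] by (simp add: integrable_restrict_space)

lemma integrable_imp_locally_integrable:
  assumes "integrable (lebesgue_on Lam) f"
  shows "locally_integrable f"
  unfolding locally_integrable_def
proof (intro allI impI)
  fix K :: "real set" assume K: "compact K \<and> K \<subseteq> interior Lam"
  have i: "integrable lebesgue (\<lambda>x. indicator {-1..1} x * f x)"
    using assms by (subst (asm) integrable_restrict_space) auto
  have "K \<in> sets lebesgue" using K by (simp add: compact_imp_closed borel_closed sets_completionI_sets)
  from integrable_lebesgue_on_if [OF i this]
  have "integrable (lebesgue_on K) (\<lambda>x. indicator {-1..1} x * f x)" .
  moreover have "K \<subseteq> Lam" using K interior_subset by blast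
  hence "integrable (lebesgue_on K) (\<lambda>x. indicator {-1..1} x * f x) \<longleftrightarrow> integrable (lebesgue_on K) f"
    by (intro Bochner_Integration.integrable_cong) (auto simp: indicator_def)
  ultimately show "integrable (lebesgue_on K) f" by simp
qed

lemma LINT_Lam_eq_lebesgue:
  assumes "\<And>x. x \<notin> Lam \<Longrightarrow> f x = (0::real)"
  shows "(LINT x|lebesgue_on Lam. f x) = (LINT x|lebesgue. f x)"
proof -
  have "(\<lambda>x. indicator Lam x *\<^sub>R f x) = f"
  proof
    show "indicator Lam x *\<^sub>R f x = f x" for x using assms [of x] by (auto simp: indicator_def)
  qed
  thus ?thesis by (subst integral_restrict_space) auto
qed

lemma test_function_measurable: "test_function \<phi> \<Longrightarrow> \<phi> \<in> borel_measurable (lebesgue_on S)"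
  by (intro measurable_restrict_space1 measurable_completion)
    (simp add: borel_measurable_continuous_onI test_function_continuous)

lemma test_function_bounded:
  assumes "test_function \<phi>"
  obtains K where "K > 0" "\<And>x. \<bar>\<phi> x\<bar> \<le> K"
proof -
  obtain a b where ab: "-1 < a" "a < b" "b < 1" "\<And>x. x \<notin> {a..b} \<Longrightarrow> \<phi> x = 0"
    using test_functionE [OF assms] by metis
  have "compact (\<phi> ` {a..b})"
    by (intro compact_continuous_image test_function_continuous assms compact_Icc)
  then obtain K where K: "K > 0" "\<And>x. x \<in> {a..b} \<Longrightarrow> \<bar>\<phi> x\<bar> \<le> K"
    using compact_imp_bounded bounded_pos by (metis imageI real_norm_def)
  show ?thesis
    by (rule that [of K]) (use K ab(4) in \<open>auto, metis abs_zero atLeastAtMost_iff less_imp_le\<close>)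
qed

lemma integrable_times_test_function:
  assumes f: "locally_integrable f" and \<phi>: "test_function \<phi>"
  shows "integrable (lebesgue_on Lam) (\<lambda>x. f x * \<phi> x)"
proof -
  obtain a b where ab: "-1 < a" "a < b" "b < 1" "\<And>x. x \<notin> {a..b} \<Longrightarrow> \<phi> x = 0"
    using test_functionE [OF \<phi>] by metis
  obtain K where K: "K > 0" "\<And>x. \<bar>\<phi> x\<bar> \<le> K" using test_function_bounded [OF \<phi>] by metis
  let ?g = "\<lambda>x. indicator {a..b} x * f x"
  have g: "integrable (lebesgue_on Lam) ?g"
    by (intro integrable_lebesgue_on_if locally_integrable_ivl f ab) auto
  have eq: "f x * \<phi> x = ?g x * \<phi> x" for x using ab(4) [of x] by (auto simp: indicator_def)
  have "integrable (lebesgue_on Lam) (\<lambda>x. ?g x * \<phi> x)"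
  proof (rule Bochner_Integration.integrable_bound)
    show "integrable (lebesgue_on Lam) (\<lambda>x. ?g x * K)" using g by simp
    show "(\<lambda>x. ?g x * \<phi> x) \<in> borel_measurable (lebesgue_on Lam)"
      by (rule borel_measurable_times [OF borel_measurable_integrable [OF g] test_function_measurable [OF \<phi>]])
    show "AE x in lebesgue_on Lam. norm (?g x * \<phi> x) \<le> norm (?g x * K)"
    proof (rule AE_I2)
      fix x
      have "\<bar>\<phi> x\<bar> \<le> \<bar>K\<bar>" using K(2) [of x] by linarith
      thus "norm (?g x * \<phi> x) \<le> norm (?g x * K)"
        unfolding real_norm_def abs_mult by (intro mult_left_mono) auto
    qed
  qed
  thus ?thesis by (simp only: eq)
qed

text \<open>Bumps are test functions and converge boundedly to the indicator of an open interval. By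
  dominated convergence the integral of f over every open interval with closure in (-1,1) is 0, so f
  vanishes almost everywhere.\<close>

lemma fundamental_lemma:
  assumes f: "locally_integrable f"
    and z: "\<And>\<phi>. test_function \<phi> \<Longrightarrow> (LINT x|lebesgue_on Lam. f x * \<phi> x) = 0"
  shows "AE x in lebesgue_on Lam. f x = 0"
proof -
  have Ioo: "(LINT x|lebesgue. indicator {a<..<b} x * f x) = 0" if ab: "-1 < a" "b < 1" for a b
  proof -
    let ?g = "\<lambda>x. indicator {a..b} x * f x"
    have g: "integrable lebesgue ?g" by (intro locally_integrable_ivl f ab)
    have "(\<lambda>n. LINT x|lebesgue. ?g x * bump (real (Suc n)) a b x) \<longlonglongrightarrow>
        (LINT x|lebesgue. ?g x * indicator {a<..<b} x)"
    proof (rule integral_dominated_convergence)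
      show "integrable lebesgue (\<lambda>x. \<bar>?g x\<bar>)" using g by (rule integrable_abs)
      show "(\<lambda>x. ?g x * bump (real (Suc n)) a b x) \<in> borel_measurable lebesgue" for n
        using test_function_measurable [OF test_function_bump, of "real (Suc n)" a b UNIV] ab
        by (intro borel_measurable_times [OF borel_measurable_integrable [OF g]])
          (simp add: lebesgue_on_UNIV_eq)
      show "(\<lambda>x. ?g x * indicator {a<..<b} x) \<in> borel_measurable lebesgue"
        by (rule borel_measurable_times [OF borel_measurable_integrable [OF g]]) (auto intro!: borel_measurable_indicator)
      show "AE x in lebesgue. (\<lambda>n. ?g x * bump (real (Suc n)) a b x) \<longlonglongrightarrow> ?g x * indicator {a<..<b} x"
        by (intro AE_I2 tendsto_mult tendsto_const bump_tendsto_indicator)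
      show "AE x in lebesgue. norm (?g x * bump (real (Suc n)) a b x) \<le> \<bar>?g x\<bar>" for n
        using bump_bounds [of "real (Suc n)" a b]
        by (intro AE_I2) (auto simp: abs_mult simp del: of_nat_Suc intro!: mult_left_le)
    qed
    moreover have "(LINT x|lebesgue. ?g x * bump (real (Suc n)) a b x) = 0" for n
    proof -
      have "?g x * bump (real (Suc n)) a b x = f x * bump (real (Suc n)) a b x" for x
      proof (cases "x \<in> {a<..<b}")
        case False
        thus ?thesis using bump_outside [of "real (Suc n)" x a b] by (simp del: of_nat_Suc)
      qed simp
      hence "(LINT x|lebesgue. ?g x * bump (real (Suc n)) a b x)
          = (LINT x|lebesgue. f x * bump (real (Suc n)) a b x)" by presburger
      also have "\<dots> = (LINT x|lebesgue_on Lam. f x * bump (real (Suc n)) a b x)"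
        using ab bump_outside [of "real (Suc n)" _ a b]
        by (intro LINT_Lam_eq_lebesgue [symmetric]) (auto simp del: of_nat_Suc)
      also have "\<dots> = 0" using ab by (intro z test_function_bump) auto
      finally show ?thesis .
    qed
    ultimately have "(LINT x|lebesgue. ?g x * indicator {a<..<b} x) = 0"
      by (simp only: LIMSEQ_const_iff)
    moreover have "?g x * indicator {a<..<b} x = indicator {a<..<b} x * f x" for x
      by (auto simp: indicator_def)
    ultimately show ?thesis by simp
  qed
  \<comment> \<open>The cut-off of f to [c,d] is integrable on the whole line, so the previous lemma
    applies. Open and half-open intervals differ only by null sets.\<close>
  have Icc: "AE x in lebesgue. indicator {c..d} x * f x = 0" if cd: "-1 < c" "d < 1" for c d
  proof (rule AE_zero_if_interval_integrals_zero)
    show int: "integrable lebesgue (\<lambda>x. indicator {c..d} x * f x)"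
      by (intro locally_integrable_ivl f cd)
    fix a b :: real
    let ?a = "max a c" and ?b = "min b d"
    have ne: "AE x in lebesgue. x \<noteq> e" for e :: real by (intro AE_completion AE_lborel_singleton)
    have "(LINT x|lebesgue. indicator {a<..b} x * (indicator {c..d} x * f x))
        = (LINT x|lebesgue. indicator {?a<..<?b} x * f x)"
    proof (rule integral_cong_AE)
      show "AE x in lebesgue. indicator {a<..b} x * (indicator {c..d} x * f x)
          = indicator {?a<..<?b} x * f x"
        using ne [of c] ne [of d] ne [of b] by eventually_elim (auto simp: indicator_def)
      have "(\<lambda>x. indicator {?a<..<?b} x * (indicator {c..d} x * f x)) \<in> borel_measurable lebesgue"
        by (rule borel_measurable_times [OF _ borel_measurable_integrable [OF int]]) (auto intro!: borel_measurable_indicator)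
      moreover have "indicator {?a<..<?b} x * (indicator {c..d} x * f x) = indicator {?a<..<?b} x * f x" for x
        by (auto simp: indicator_def)
      ultimately show "(\<lambda>x. indicator {?a<..<?b} x * f x) \<in> borel_measurable lebesgue" by simp
      show "(\<lambda>x. indicator {a<..b} x * (indicator {c..d} x * f x)) \<in> borel_measurable lebesgue"
        by (rule borel_measurable_times [OF _ borel_measurable_integrable [OF int]]) (auto intro!: borel_measurable_indicator)
    qed
    also have "\<dots> = 0" using cd by (intro Ioo) auto
    finally show "(LINT x|lebesgue. indicator {a<..b} x * (indicator {c..d} x * f x)) = 0" .
  qed
  \<comment> \<open>f is only locally integrable, so (-1,1) is exhausted by countably many compact
    intervals; the points -1 and 1 are null.\<close>
  define c where "c n = 1 - inverse (real (Suc n))" for n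
  have "c n < 1" for n unfolding c_def by simp
  hence "AE x in lebesgue. indicator {- c n..c n} x * f x = 0" for n
    by (intro Icc) auto
  hence "AE x in lebesgue. \<forall>n. indicator {- c n..c n} x * f x = 0"
    by (subst AE_all_countable) blast
  moreover have "AE x in lebesgue. x \<noteq> (e::real)" for e
    by (intro AE_completion AE_lborel_singleton)
  from this [of 1] this [of "-1"] have "AE x in lebesgue. x \<noteq> (1::real) \<and> x \<noteq> -1" by eventually_elim simp
  ultimately have "AE x in lebesgue. x \<in> Lam \<longrightarrow> f x = 0"
  proof eventually_elim
    case (elim x)
    show ?case
    proof
      assume "x \<in> Lam"
      hence "\<bar>x\<bar> < 1" using elim by auto
      then obtain n where "inverse (real (Suc n)) < 1 - \<bar>x\<bar>" using reals_Archimedean [of "1 - \<bar>x\<bar>"] by auto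
      hence "x \<in> {- c n..c n}" unfolding c_def by (auto simp del: of_nat_Suc)
      thus "f x = 0" using elim(1) [rule_format, of n] by simp
    qed
  qed
  thus ?thesis by (subst AE_restrict_space_iff) auto
qed

section \<open>Weak derivatives\<close>

lemma is_weak_derivD:
  assumes "is_weak_deriv k u v"
  shows "locally_integrable u" "locally_integrable v"
    "\<And>\<phi>. test_function \<phi> \<Longrightarrow> (LINT x|lebesgue_on Lam. u x * (deriv ^^ k) \<phi> x)
          = (-1) ^ k * (LINT x|lebesgue_on Lam. v x * \<phi> x)"
  using assms by (auto simp: is_weak_deriv_def)

lemma locally_integrable_add:
  "locally_integrable u \<Longrightarrow> locally_integrable v \<Longrightarrow> locally_integrable (\<lambda>x. u x + v x)"
  unfolding locally_integrable_def by auto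

lemma locally_integrable_diff:
  "locally_integrable u \<Longrightarrow> locally_integrable v \<Longrightarrow> locally_integrable (\<lambda>x. u x - v x)"
  unfolding locally_integrable_def by auto

lemma AE_eq_if_test_integrals_eq:
  assumes "locally_integrable v" "locally_integrable w"
    and "\<And>\<phi>. test_function \<phi> \<Longrightarrow>
      (LINT x|lebesgue_on Lam. v x * \<phi> x) = (LINT x|lebesgue_on Lam. w x * \<phi> x)"
  shows "AE x in lebesgue_on Lam. v x = w x"
proof -
  have "AE x in lebesgue_on Lam. v x - w x = 0"
  proof (rule fundamental_lemma)
    show "locally_integrable (\<lambda>x. v x - w x)" using assms by (intro locally_integrable_diff)
    fix \<phi> assume "test_function \<phi>"
    thus "(LINT x|lebesgue_on Lam. (v x - w x) * \<phi> x) = 0"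
      using assms integrable_times_test_function by (simp add: left_diff_distrib)
  qed
  thus ?thesis by simp
qed

text \<open>This makes the choice of representative in \<open>weak_deriv\<close> immaterial up to
  null sets.\<close>

lemma weak_deriv_unique:
  assumes "is_weak_deriv k u v" "is_weak_deriv k u w"
  shows "AE x in lebesgue_on Lam. v x = w x"
proof (rule AE_eq_if_test_integrals_eq)
  fix \<phi> assume "test_function \<phi>"
  thus "(LINT x|lebesgue_on Lam. v x * \<phi> x) = (LINT x|lebesgue_on Lam. w x * \<phi> x)"
    using is_weak_derivD(3) [OF assms(1)] is_weak_derivD(3) [OF assms(2)] by simp
qed (use assms is_weak_derivD in blast)+

text \<open>\<open>weak_deriv 0 u\<close> is a chosen representative as well, so equality with
  \<open>u\<close> can only be expected almost everywhere.\<close>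

lemma weak_deriv_0_AE_eq: "is_weak_deriv 0 u v \<Longrightarrow> AE x in lebesgue_on Lam. v x = u x"
  by (rule weak_deriv_unique [of 0 u]) (auto simp: is_weak_deriv_def)

text \<open>Use \<open>deriv \<phi>\<close> as a test function in the identity of order j and
  compare with the identity of order j + 1 for \<phi>. It turns the derivatives of e in the Sobolev
  space, each defined directly from e, into a sequence of successive first derivatives.\<close>

lemma is_weak_deriv_step:
  assumes "is_weak_deriv j u v" "is_weak_deriv (Suc j) u w"
  shows "is_weak_deriv 1 v w"
  unfolding is_weak_deriv_def
proof (intro conjI allI impI)
  fix \<phi> assume \<phi>: "test_function \<phi>"
  have "(LINT x|lebesgue_on Lam. u x * (deriv ^^ j) (deriv \<phi>) x)
      = (-1) ^ j * (LINT x|lebesgue_on Lam. v x * deriv \<phi> x)"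
    by (rule is_weak_derivD(3) [OF assms(1) test_function_deriv [OF \<phi>]])
  moreover have "(LINT x|lebesgue_on Lam. u x * (deriv ^^ Suc j) \<phi> x)
      = (-1) ^ Suc j * (LINT x|lebesgue_on Lam. w x * \<phi> x)"
    by (rule is_weak_derivD(3) [OF assms(2) \<phi>])
  ultimately have "(-1) ^ j * (LINT x|lebesgue_on Lam. v x * deriv \<phi> x)
      = (-1) ^ j * (- (LINT x|lebesgue_on Lam. w x * \<phi> x))"
    by (simp add: funpow_swap1)
  hence "(LINT x|lebesgue_on Lam. v x * deriv \<phi> x) = - (LINT x|lebesgue_on Lam. w x * \<phi> x)"
    by (rule mult_left_cancel [THEN iffD1, rotated]) simp
  thus "(LINT x|lebesgue_on Lam. v x * (deriv ^^ 1) \<phi> x) = (-1) ^ 1 * (LINT x|lebesgue_on Lam. w x * \<phi> x)"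
    by simp
qed (use assms is_weak_derivD in blast)+

lemma FTC_lebesgue_on:
  fixes F F' :: "real \<Rightarrow> real"
  assumes "a \<le> b" "\<And>x. x \<in> {a..b} \<Longrightarrow> (F has_real_derivative F' x) (at x within {a..b})" "continuous_on {a..b} F'"
  shows "(LINT x|lebesgue_on {a..b}. F' x) = F b - F a"
proof -
  have "(F' has_integral (F b - F a)) {a..b}"
    using assms by (intro fundamental_theorem_of_calculus)
      (auto simp: has_real_derivative_iff_has_vector_derivative)
  moreover have "(F' has_integral (LINT x|lebesgue_on {a..b}. F' x)) {a..b}"
    using assms by (intro has_integral_integral_lebesgue_on continuous_imp_integrable_real) auto
  ultimately show ?thesis using has_integral_unique by blast
qed

text \<open>Integration by parts: the integral of (q \<phi>)' over [-1,1] is 0 because \<phi>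
  vanishes at both ends.\<close>

lemma is_weak_deriv_classical:
  assumes "\<And>x. (q has_real_derivative q' x) (at x)" "continuous_on UNIV q'"
  shows "is_weak_deriv 1 q q'"
  unfolding is_weak_deriv_def
proof (intro conjI allI impI)
  have cq: "continuous_on UNIV q" using assms(1) by (meson DERIV_isCont continuous_at_imp_continuous_on)
  have li: "locally_integrable f" if "continuous_on UNIV f" for f
    using continuous_on_subset [OF that]
    by (intro integrable_imp_locally_integrable continuous_imp_integrable_real) auto
  show liq: "locally_integrable q" "locally_integrable q'" using li cq assms(2) by auto
  fix \<phi> assume \<phi>: "test_function \<phi>"
  obtain a b where ab: "-1 < a" "a < b" "b < 1" "\<And>x. x \<notin> {a..b} \<Longrightarrow> \<phi> x = 0"
    using test_functionE [OF \<phi>] by metis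
  have "(LINT x|lebesgue_on Lam. q x * deriv \<phi> x + q' x * \<phi> x) = q 1 * \<phi> 1 - q (-1) * \<phi> (-1)"
  proof (rule FTC_lebesgue_on)
    fix x
    have "((\<lambda>x. q x * \<phi> x) has_real_derivative q' x * \<phi> x + deriv \<phi> x * q x) (at x)"
      by (intro DERIV_mult assms smooth_has_deriv test_function_smooth \<phi>)
    thus "((\<lambda>x. q x * \<phi> x) has_real_derivative q x * deriv \<phi> x + q' x * \<phi> x) (at x within {- 1..1})"
      by (rule has_field_derivative_at_within [OF DERIV_cong]) (simp add: mult.commute add.commute)
    show "continuous_on {- 1..1} (\<lambda>x. q x * deriv \<phi> x + q' x * \<phi> x)"
      by (intro continuous_on_add continuous_on_mult test_function_continuous [OF test_function_deriv [OF \<phi>]]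
          test_function_continuous [OF \<phi>] continuous_on_subset [OF cq] continuous_on_subset [OF assms(2)]) auto
  qed simp
  also have "\<dots> = 0" using ab by simp
  finally show "(LINT x|lebesgue_on Lam. q x * (deriv ^^ 1) \<phi> x) = (-1) ^ 1 * (LINT x|lebesgue_on Lam. q' x * \<phi> x)"
    using integrable_times_test_function [OF liq(1) test_function_deriv [OF \<phi>]]
      integrable_times_test_function [OF liq(2) \<phi>] by simp
qed

lemma is_weak_deriv_add:
  assumes "is_weak_deriv k u v" "is_weak_deriv k u' v'"
  shows "is_weak_deriv k (\<lambda>x. u x + u' x) (\<lambda>x. v x + v' x)"
  unfolding is_weak_deriv_def
proof (intro conjI allI impI)
  note l = is_weak_derivD [OF assms(1)] is_weak_derivD [OF assms(2)]
  show "locally_integrable (\<lambda>x. u x + u' x)" "locally_integrable (\<lambda>x. v x + v' x)"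
    using l by (auto intro: locally_integrable_add)
  fix \<phi> assume \<phi>: "test_function \<phi>"
  note \<phi>k = test_function_deriv_funpow [OF \<phi>, of k]
  show "(LINT x|lebesgue_on Lam. (u x + u' x) * (deriv ^^ k) \<phi> x)
      = (-1) ^ k * (LINT x|lebesgue_on Lam. (v x + v' x) * \<phi> x)"
    using integrable_times_test_function [OF l(1) \<phi>k] integrable_times_test_function [OF l(4) \<phi>k]
      integrable_times_test_function [OF l(2) \<phi>] integrable_times_test_function [OF l(5) \<phi>]
      l(3) [OF \<phi>] l(6) [OF \<phi>]
    by (simp add: distrib_right distrib_left)
qed

section \<open>The du Bois-Reymond lemma and weak primitives\<close>

interpretation Lam: finite_measure "lebesgue_on Lam"
  by (metis cbox_interval finite_measure_lebesgue_on lmeasurable_cbox)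

interpretation Lam2: pair_sigma_finite "lebesgue_on Lam" "lebesgue_on Lam" ..

lemma Lam_id_measurable [measurable]: "(\<lambda>x. x) \<in> borel_measurable (lebesgue_on Lam)"
  using id_borel_measurable_lebesgue_on [of Lam] by (simp add: id_def)

text \<open>The primitive starting at -1 vanishes to the left of the support of \<rho>, and the zero
  total integral makes it vanish to the right as well.\<close>

lemma test_function_antiderivative:
  assumes \<rho>: "test_function \<rho>" and z: "(LINT x|lebesgue_on Lam. \<rho> x) = 0"
  obtains \<chi> where "test_function \<chi>" "\<And>x. (\<chi> has_real_derivative \<rho> x) (at x)"
proof -
  obtain a b where ab: "-1 < a" "a < b" "b < 1" "\<And>x. x \<notin> {a..b} \<Longrightarrow> \<rho> x = 0"
    using test_functionE [OF \<rho>] by metis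
  obtain G where G: "\<And>x. x \<in> Lam \<Longrightarrow> (G has_real_derivative \<rho> x) (at x within Lam)"
    using antiderivative_continuous [OF test_function_continuous [OF \<rho>]]
    by (metis has_real_derivative_iff_has_vector_derivative)
  have FTC: "(LINT x|lebesgue_on {c..d}. \<rho> x) = G d - G c" if "c \<le> d" "-1 \<le> c" "d \<le> 1" for c d
    using that test_function_continuous [OF \<rho>]
    by (intro FTC_lebesgue_on) (auto intro!: has_field_derivative_subset [OF G])
  have G1: "G 1 = G (-1)" using FTC [of "-1" 1] z by simp
  \<comment> \<open>\<open>G\<close> is an antiderivative on [-1,1] only. Extending by 0 creates no
    kink, because \<open>G x - G (-1)\<close> is already 0 near both ends.\<close>
  define \<chi> where "\<chi> x = (if x \<in> Lam then G x - G (-1) else 0)" for x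
  have l: "\<chi> x = 0" if "x < a" for x
  proof (cases "x \<in> Lam")
    case True
    have "(LINT x|lebesgue_on {-1..x}. \<rho> x) = (LINT x|lebesgue_on {-1..x}. 0)"
      using that ab by (intro Bochner_Integration.integral_cong) auto
    thus ?thesis using FTC [of "-1" x] True by (simp add: \<chi>_def)
  next
    case False
    thus ?thesis unfolding \<chi>_def by (rule if_not_P)
  qed
  have r: "\<chi> x = 0" if "x > b" for x
  proof (cases "x \<in> Lam")
    case True
    have "(LINT x|lebesgue_on {x..1}. \<rho> x) = (LINT x|lebesgue_on {x..1}. 0)"
      using that ab by (intro Bochner_Integration.integral_cong) auto
    thus ?thesis using FTC [of x 1] True G1 by (simp add: \<chi>_def)
  next
    case False
    thus ?thesis unfolding \<chi>_def by (rule if_not_P)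
  qed
  have outside: "\<chi> x = 0" if "x \<notin> {a..b}" for x using that l [of x] r [of x] by auto
  have d: "(\<chi> has_real_derivative \<rho> x) (at x)" for x
  proof -
    consider "x \<in> {..<a}" | "x \<in> {b<..}" | "x \<in> {-1<..<1}" using ab by force
    thus ?thesis
    proof cases
      case 1
      have "\<forall>\<^sub>F y in nhds x. y \<in> {..<a}" using 1 by (intro eventually_nhds_in_open) auto
      hence "\<forall>\<^sub>F y in nhds x. \<chi> y = 0" by eventually_elim (auto intro: l)
      from DERIV_cong_ev [OF refl this refl, of 0] show ?thesis using 1 ab by simp
    next
      case 2
      have "\<forall>\<^sub>F y in nhds x. y \<in> {b<..}" using 2 by (intro eventually_nhds_in_open) auto
      hence "\<forall>\<^sub>F y in nhds x. \<chi> y = 0" by eventually_elim (auto intro: r)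
      from DERIV_cong_ev [OF refl this refl, of 0] show ?thesis using 2 ab by simp
    next
      case 3
      have "\<forall>\<^sub>F y in nhds x. y \<in> {-1<..<1}" using 3 by (intro eventually_nhds_in_open) auto
      hence ev: "\<forall>\<^sub>F y in nhds x. \<chi> y = G y - G (-1)" by eventually_elim (auto simp: \<chi>_def)
      have "x \<in> interior Lam" using 3 by (simp add: interior_atLeastAtMost_real)
      hence "(G has_real_derivative \<rho> x) (at x)"
        using G [of x] 3 at_within_interior [of x Lam] by simp
      hence "((\<lambda>y. G y - G (-1)) has_real_derivative \<rho> x) (at x)"
        by (auto intro!: derivative_eq_intros)
      thus ?thesis using DERIV_cong_ev [OF refl ev refl] by blast
    qed
  qed
  have "test_function \<chi>"
    by (rule test_functionI [OF smooth_from_deriv [OF d test_function_smooth [OF \<rho>]] ab(1) ab(3) outside])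
  thus ?thesis using d that by blast
qed

text \<open>If the integral were 0, the bump would have an antiderivative that is a test function.
  This antiderivative is nondecreasing, strictly increasing on the middle third of [a,b], and yet 0
  at both -1 and 1.\<close>

lemma integral_bump_pos:
  assumes "-1 < a" "a < b" "b < 1"
  shows "(LINT x|lebesgue_on Lam. bump 1 a b x) > 0"
proof (rule ccontr)
  assume "\<not> ?thesis"
  moreover have "(LINT x|lebesgue_on Lam. bump 1 a b x) \<ge> 0"
    using bump_bounds by (intro integral_nonneg_AE) auto
  ultimately have "(LINT x|lebesgue_on Lam. bump 1 a b x) = 0" by simp
  moreover have "test_function (bump 1 a b)" using assms by (intro test_function_bump) auto
  ultimately obtain \<chi> where \<chi>: "test_function \<chi>" "\<And>x. (\<chi> has_real_derivative bump 1 a b x) (at x)"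
    using test_function_antiderivative by metis
  obtain c d where cd: "-1 < c" "c < d" "d < 1" "\<And>x. x \<notin> {c..d} \<Longrightarrow> \<chi> x = 0"
    using test_functionE [OF \<chi>(1)] by metis
  have mono: "\<chi> x \<le> \<chi> y" if "x \<le> y" for x y
    by (rule DERIV_nonneg_imp_nondecreasing [OF that]) (intro exI conjI, rule \<chi>(2), rule bump_bounds(1))
  define p q where "p = (2 * a + b) / 3" and "q = (a + 2 * b) / 3"
  have pq: "a < p" "p < q" "q < b" using assms by (auto simp: p_def q_def)
  have "\<chi> p < \<chi> q"
  proof (rule DERIV_pos_imp_increasing [OF pq(2)])
    fix x assume "p \<le> x" "x \<le> q"
    hence "bump 1 a b x > 0" using pq by (intro bump_pos) auto
    thus "\<exists>y. (\<chi> has_real_derivative y) (at x) \<and> 0 < y" using \<chi>(2) by blast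
  qed
  moreover have "\<chi> (-1) \<le> \<chi> p" "\<chi> q \<le> \<chi> 1" using pq assms by (auto intro!: mono)
  ultimately show False using cd by simp
qed

text \<open>The support [1/4,3/4] lies inside (-1,1), so \<eta> is a test function, and strictly
  inside (0,1), so its copy on an interval (a,a+h] stays away from the ends even if a = -1 or a + h
  = 1.\<close>

lemma unit_bump:
  obtains \<eta> K where "smooth \<eta>" "\<And>x. x \<notin> {1/4..3/4} \<Longrightarrow> \<eta> x = 0" "(LINT x|lebesgue_on Lam. \<eta> x) = 1"
    "K > 0" "\<And>x. \<bar>\<eta> x\<bar> \<le> K" "\<And>x. \<bar>deriv \<eta> x\<bar> \<le> K"
proof -
  define I where "I = (LINT x|lebesgue_on Lam. bump 1 (1/4) (3/4) x)"
  have I: "I > 0" unfolding I_def by (intro integral_bump_pos) auto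
  define \<eta> where "\<eta> x = inverse I * bump 1 (1/4) (3/4) x" for x
  have sm: "smooth \<eta>" unfolding \<eta>_def by (intro smooth_cmult smooth_bump)
  have out: "\<eta> x = 0" if "x \<notin> {1/4..3/4}" for x
    using that bump_outside [of 1 x "1/4" "3/4"] by (auto simp: \<eta>_def)
  have t: "test_function \<eta>" by (rule test_functionI [of _ "1/4" "3/4", OF sm _ _ out]) auto
  obtain K where K: "K > 0" "\<And>x. \<bar>\<eta> x\<bar> \<le> K" using test_function_bounded [OF t] by metis
  obtain K' where K': "K' > 0" "\<And>x. \<bar>deriv \<eta> x\<bar> \<le> K'"
    using test_function_bounded [OF test_function_deriv [OF t]] by metis
  show ?thesis
  proof (rule that [of \<eta> "max K K'"])
    show "(LINT x|lebesgue_on Lam. \<eta> x) = 1" unfolding \<eta>_def using I by (simp flip: I_def)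
  qed (use sm out K K' in \<open>auto simp: max.coboundedI1 max.coboundedI2\<close>)
qed

lemma locally_integrable_const: "locally_integrable (\<lambda>x. c)"
  by (rule integrable_imp_locally_integrable) simp

lemma integrable_test_function: "test_function \<phi> \<Longrightarrow> integrable (lebesgue_on Lam) \<phi>"
  using integrable_times_test_function [OF locally_integrable_const [of 1]] by simp

text \<open>Subtracting from \<phi> its integral times a fixed bump \<eta> of unit mass leaves a
  test function of integral 0, hence the derivative of a test function, which v annihilates. So
  integrating v against \<phi> amounts to integrating the constant c against \<phi>, where c is the
  integral of v \<eta>.\<close>

lemma du_Bois_Reymond:
  assumes v: "locally_integrable v"
    and z: "\<And>\<phi>. test_function \<phi> \<Longrightarrow> (LINT x|lebesgue_on Lam. v x * deriv \<phi> x) = 0"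
  obtains c where "AE x in lebesgue_on Lam. v x = c"
proof -
  obtain \<eta> K where \<eta>: "smooth \<eta>" "\<And>x. x \<notin> {1/4..3/4} \<Longrightarrow> \<eta> x = 0" "(LINT x|lebesgue_on Lam. \<eta> x) = 1"
    using unit_bump by metis
  have t\<eta>: "test_function \<eta>" by (rule test_functionI [of _ "1/4" "3/4", OF \<eta>(1) _ _ \<eta>(2)]) auto
  define c where "c = (LINT x|lebesgue_on Lam. v x * \<eta> x)"
  have "AE x in lebesgue_on Lam. v x = c"
  proof (rule AE_eq_if_test_integrals_eq [OF v locally_integrable_const])
    fix \<phi> assume \<phi>: "test_function \<phi>"
    define k where "k = (LINT x|lebesgue_on Lam. \<phi> x)"
    obtain a b where ab: "-1 < a" "a < b" "b < 1" "\<And>x. x \<notin> {a..b} \<Longrightarrow> \<phi> x = 0"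
      using test_functionE [OF \<phi>] by metis
    have t: "test_function (\<lambda>x. \<phi> x + (- k) * \<eta> x)"
    proof (rule test_functionI [of _ "min a (1/4)" "max b (3/4)"])
      show "smooth (\<lambda>x. \<phi> x + (- k) * \<eta> x)"
        by (rule smooth_add [OF test_function_smooth [OF \<phi>] smooth_cmult [OF \<eta>(1)]])
      fix x assume "x \<notin> {min a (1 / 4)..max b (3 / 4)}"
      hence "x \<notin> {a..b}" "x \<notin> {1/4..3/4}" by auto
      thus "\<phi> x + (- k) * \<eta> x = 0" using ab(4) \<eta>(2) by simp
    qed (use ab in auto)
    have "(LINT x|lebesgue_on Lam. \<phi> x + (- k) * \<eta> x) = 0"
      using integrable_test_function [OF \<phi>] integrable_test_function [OF t\<eta>] \<eta>(3) by (simp add: k_def)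
    from test_function_antiderivative [OF t this] obtain \<chi>
      where \<chi>: "test_function \<chi>" "\<And>x. (\<chi> has_real_derivative \<phi> x + (- k) * \<eta> x) (at x)" by metis
    have "deriv \<chi> = (\<lambda>x. \<phi> x + (- k) * \<eta> x)" using \<chi>(2) by (auto intro!: DERIV_imp_deriv)
    hence "0 = (LINT x|lebesgue_on Lam. v x * (\<phi> x + (- k) * \<eta> x))" using z [OF \<chi>(1)] by simp
    also have "\<dots> = (LINT x|lebesgue_on Lam. v x * \<phi> x - k * (v x * \<eta> x))" by (simp add: algebra_simps)
    also have "\<dots> = (LINT x|lebesgue_on Lam. v x * \<phi> x) - k * c"
      using integrable_times_test_function [OF v \<phi>] integrable_times_test_function [OF v t\<eta>]
      by (simp add: c_def)
    finally show "(LINT x|lebesgue_on Lam. v x * \<phi> x) = (LINT x|lebesgue_on Lam. c * \<phi> x)"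
      by (simp add: k_def)
  qed
  thus ?thesis by (rule that)
qed

section \<open>Primitives of integrable functions\<close>

text \<open>The integrand is cut off at x while the domain stays [-1,1], so that the integrand is a
  jointly measurable function on the square and Fubini applies.\<close>

definition primitive :: "(real \<Rightarrow> real) \<Rightarrow> real \<Rightarrow> real" where
  "primitive w x = (LINT y|lebesgue_on Lam. (if y \<le> x then w y else 0))"

lemma integrable_if_le:
  fixes w :: "real \<Rightarrow> real"
  assumes "integrable (lebesgue_on Lam) w"
  shows "integrable (lebesgue_on Lam) (\<lambda>y. if y \<le> x then w y else 0)"
  by (rule Bochner_Integration.integrable_bound [OF assms]) (use assms in auto)

lemma primitive_diff:
  assumes "integrable (lebesgue_on Lam) w" "y \<le> x"
  shows "primitive w x - primitive w y = (LINT z|lebesgue_on Lam. indicator {y<..x} z * w z)"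
proof -
  have "primitive w x - primitive w y =
      (LINT z|lebesgue_on Lam. (if z \<le> x then w z else 0) - (if z \<le> y then w z else 0))"
    unfolding primitive_def by (intro Bochner_Integration.integral_diff [symmetric] integrable_if_le assms)
  also have "\<dots> = (LINT z|lebesgue_on Lam. indicator {y<..x} z * w z)"
    using assms(2) by (intro Bochner_Integration.integral_cong) (auto simp: indicator_def)
  finally show ?thesis .
qed

lemma measurable_if_le_pair:
  fixes w :: "real \<Rightarrow> real"
  assumes [measurable]: "w \<in> borel_measurable (lebesgue_on Lam)"
  shows "(\<lambda>(x, y). if y \<le> x then w y else 0) \<in> borel_measurable (lebesgue_on Lam \<Otimes>\<^sub>M lebesgue_on Lam)"
  by measurable

lemma integrable_primitive:
  assumes w: "integrable (lebesgue_on Lam) w"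
  shows "integrable (lebesgue_on Lam) (primitive w)"
proof (rule Bochner_Integration.integrable_bound)
  show "integrable (lebesgue_on Lam) (\<lambda>x. LINT y|lebesgue_on Lam. \<bar>w y\<bar>)" by simp
  show "primitive w \<in> borel_measurable (lebesgue_on Lam)"
    unfolding primitive_def
    using measurable_if_le_pair [OF borel_measurable_integrable [OF w]]
    by (intro Lam.borel_measurable_lebesgue_integral) (simp add: case_prod_unfold)
  show "AE x in lebesgue_on Lam. norm (primitive w x) \<le> norm (LINT y|lebesgue_on Lam. \<bar>w y\<bar>)"
  proof (rule AE_I2)
    fix x
    have "\<bar>primitive w x\<bar> \<le> (LINT y|lebesgue_on Lam. \<bar>(if y \<le> x then w y else 0)\<bar>)"
      unfolding primitive_def by (rule integral_abs_bound)
    also have "\<dots> \<le> (LINT y|lebesgue_on Lam. \<bar>w y\<bar>)"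
      using w integrable_if_le [OF w, of x] by (intro integral_mono) auto
    finally show "norm (primitive w x) \<le> norm (LINT y|lebesgue_on Lam. \<bar>w y\<bar>)" by simp
  qed
qed

text \<open>By Fubini, integrating the primitive against \<phi>' gives the integral of w(y) times
  the integral of \<phi>' over [y,1], and the latter is -\<phi>(y) because \<phi>(1) = 0.\<close>

lemma is_weak_deriv_primitive:
  assumes w: "integrable (lebesgue_on Lam) w"
  shows "is_weak_deriv 1 (primitive w) w"
  unfolding is_weak_deriv_def
proof (intro conjI allI impI)
  show "locally_integrable (primitive w)" "locally_integrable w"
    using w integrable_primitive integrable_imp_locally_integrable by auto
  fix \<phi> assume \<phi>: "test_function \<phi>"
  note \<phi>' = test_function_deriv [OF \<phi>]
  have [measurable]: "w \<in> borel_measurable (lebesgue_on Lam)" "deriv \<phi> \<in> borel_measurable (lebesgue_on Lam)"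
    using w test_function_measurable [OF \<phi>'] by auto
  obtain K where K: "K > 0" "\<And>x. \<bar>deriv \<phi> x\<bar> \<le> K" using test_function_bounded [OF \<phi>'] by metis
  obtain a b where ab: "-1 < a" "a < b" "b < 1" "\<And>x. x \<notin> {a..b} \<Longrightarrow> \<phi> x = 0"
    using test_functionE [OF \<phi>] by metis
  let ?f = "\<lambda>x y. (if y \<le> x then w y else 0) * deriv \<phi> x"
  have f_int: "integrable (lebesgue_on Lam) (?f x)" for x
    using integrable_if_le [OF w, of x] by simp
  have f_meas: "case_prod ?f \<in> borel_measurable (lebesgue_on Lam \<Otimes>\<^sub>M lebesgue_on Lam)"
    by measurable
  have "integrable (lebesgue_on Lam \<Otimes>\<^sub>M lebesgue_on Lam) (case_prod ?f)"
  proof (rule Lam2.Fubini_integrable [OF f_meas])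
    show "AE x in lebesgue_on Lam. integrable (lebesgue_on Lam) (\<lambda>y. case (x, y) of (x, y) \<Rightarrow> ?f x y)"
      using f_int by simp
    show "integrable (lebesgue_on Lam) (\<lambda>x. LINT y|lebesgue_on Lam. norm (case (x, y) of (x, y) \<Rightarrow> ?f x y))"
    proof (rule Bochner_Integration.integrable_bound)
      show "integrable (lebesgue_on Lam) (\<lambda>x. K * (LINT y|lebesgue_on Lam. \<bar>w y\<bar>))" by simp
      show "(\<lambda>x. LINT y|lebesgue_on Lam. norm (case (x, y) of (x, y) \<Rightarrow> ?f x y)) \<in> borel_measurable (lebesgue_on Lam)"
        using f_meas by (intro Lam.borel_measurable_lebesgue_integral) (simp add: case_prod_unfold)
      show "AE x in lebesgue_on Lam. norm (LINT y|lebesgue_on Lam. norm (case (x, y) of (x, y) \<Rightarrow> ?f x y))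
          \<le> norm (K * (LINT y|lebesgue_on Lam. \<bar>w y\<bar>))"
      proof (rule AE_I2)
        fix x
        have "(LINT y|lebesgue_on Lam. \<bar>?f x y\<bar>) \<le> (LINT y|lebesgue_on Lam. K * \<bar>w y\<bar>)"
          using K f_int [of x] w by (intro integral_mono)
            (auto simp: abs_mult mult.commute [of K] intro!: mult_left_mono integrable_abs)
        thus "norm (LINT y|lebesgue_on Lam. norm (case (x, y) of (x, y) \<Rightarrow> ?f x y))
          \<le> norm (K * (LINT y|lebesgue_on Lam. \<bar>w y\<bar>))"
          using K by (simp add: abs_mult)
      qed
    qed
  qed
  from Lam2.Fubini_integral [OF this]
  have "(LINT x|lebesgue_on Lam. LINT y|lebesgue_on Lam. ?f x y)
      = (LINT y|lebesgue_on Lam. LINT x|lebesgue_on Lam. ?f x y)" by simp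
  also have "\<dots> = (LINT y|lebesgue_on Lam. - (w y * \<phi> y))"
  proof (rule Bochner_Integration.integral_cong)
    fix y assume "y \<in> space (lebesgue_on Lam)"
    hence y: "y \<in> Lam" by simp
    have "(LINT x|lebesgue_on Lam. ?f x y) = (LINT x|lebesgue_on Lam. w y * (if x \<in> {y..1} then deriv \<phi> x else 0))"
      by (intro Bochner_Integration.integral_cong) auto
    also have "\<dots> = w y * (LINT x|lebesgue_on {y..1}. deriv \<phi> x)"
    proof -
      have "{y..1} \<subseteq> Lam" using y by auto
      from integral_restrict [OF this, of "deriv \<phi>"] show ?thesis by (simp del: atLeastAtMost_iff)
    qed
    also have "(LINT x|lebesgue_on {y..1}. deriv \<phi> x) = \<phi> 1 - \<phi> y"
      using y by (intro FTC_lebesgue_on has_field_derivative_at_within [OF smooth_has_deriv]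
          test_function_smooth [OF \<phi>] test_function_continuous [OF \<phi>']) auto
    finally show "(LINT x|lebesgue_on Lam. ?f x y) = - (w y * \<phi> y)" using ab by simp
  qed simp
  also have "(LINT x|lebesgue_on Lam. LINT y|lebesgue_on Lam. ?f x y)
      = (LINT x|lebesgue_on Lam. primitive w x * deriv \<phi> x)"
    unfolding primitive_def by simp
  finally show "(LINT x|lebesgue_on Lam. primitive w x * (deriv ^^ 1) \<phi> x)
      = (-1) ^ 1 * (LINT x|lebesgue_on Lam. w x * \<phi> x)" by simp
qed

text \<open>The difference of v and the primitive has weak derivative 0, so it is constant by du
  Bois-Reymond. This gives access to the increments of v.\<close>

lemma weak_deriv_AE_primitive:
  assumes d: "is_weak_deriv 1 v w" and w: "integrable (lebesgue_on Lam) w"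
  obtains c where "AE x in lebesgue_on Lam. v x = c + primitive w x"
proof -
  note l = is_weak_derivD [OF d] is_weak_derivD [OF is_weak_deriv_primitive [OF w]]
  have li: "locally_integrable (\<lambda>x. v x - primitive w x)" by (intro locally_integrable_diff l)
  have "(LINT x|lebesgue_on Lam. (v x - primitive w x) * deriv \<phi> x) = 0" if \<phi>: "test_function \<phi>" for \<phi>
    using l(3) [OF \<phi>] l(6) [OF \<phi>] integrable_times_test_function [OF l(1) test_function_deriv [OF \<phi>]]
      integrable_times_test_function [OF l(4) test_function_deriv [OF \<phi>]]
    by (simp add: left_diff_distrib)
  from du_Bois_Reymond [OF li this] obtain c where "AE x in lebesgue_on Lam. v x - primitive w x = c" by metis
  hence "AE x in lebesgue_on Lam. v x = c + primitive w x" by eventually_elim simp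
  thus ?thesis by (rule that)
qed

section \<open>Square integrable functions\<close>

lemma square_integrableD:
  assumes "square_integrable u"
  shows "u \<in> borel_measurable (lebesgue_on Lam)" "integrable (lebesgue_on Lam) (\<lambda>x. (u x)\<^sup>2)"
  using assms by (auto simp: square_integrable_def)

lemma square_integrable_imp_integrable:
  assumes "square_integrable u"
  shows "integrable (lebesgue_on Lam) u"
proof (rule Bochner_Integration.integrable_bound)
  show "integrable (lebesgue_on Lam) (\<lambda>x. 1 + (u x)\<^sup>2)"
    using square_integrableD(2) [OF assms] by simp
  show "AE x in lebesgue_on Lam. norm (u x) \<le> norm (1 + (u x)\<^sup>2)"
  proof (rule AE_I2)
    fix x
    have "0 \<le> (\<bar>u x\<bar> - 1)\<^sup>2" by simp
    hence "2 * \<bar>u x\<bar> \<le> 1 + (u x)\<^sup>2" by (simp add: power2_diff)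
    thus "norm (u x) \<le> norm (1 + (u x)\<^sup>2)" by simp
  qed
qed (use square_integrableD [OF assms] in auto)

lemma square_integrable_mult_bounded:
  assumes u: "square_integrable u" and "\<psi> \<in> borel_measurable (lebesgue_on Lam)" "\<And>x. \<bar>\<psi> x\<bar> \<le> K"
  shows "square_integrable (\<lambda>x. u x * \<psi> x)"
  unfolding square_integrable_def
proof
  note m [measurable] = square_integrableD(1) [OF u] assms(2)
  show "(\<lambda>x. u x * \<psi> x) \<in> borel_measurable (lebesgue_on Lam)" by measurable
  show "integrable (lebesgue_on Lam) (\<lambda>x. (u x * \<psi> x)\<^sup>2)"
  proof (rule Bochner_Integration.integrable_bound)
    show "integrable (lebesgue_on Lam) (\<lambda>x. (u x)\<^sup>2 * K\<^sup>2)" using square_integrableD(2) [OF u] by simp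
    show "AE x in lebesgue_on Lam. norm ((u x * \<psi> x)\<^sup>2) \<le> norm ((u x)\<^sup>2 * K\<^sup>2)"
    proof (rule AE_I2)
      fix x
      have "(\<psi> x)\<^sup>2 \<le> K\<^sup>2" using assms(3) [of x] by (metis abs_ge_zero power2_abs power_mono)
      thus "norm ((u x * \<psi> x)\<^sup>2) \<le> norm ((u x)\<^sup>2 * K\<^sup>2)"
        by (simp add: power_mult_distrib mult_left_mono)
    qed
  qed measurable
qed

lemma square_integrable_const_diff:
  assumes "square_integrable v"
  shows "square_integrable (\<lambda>y. c - v y)"
proof -
  note m [measurable] = square_integrableD(1) [OF assms]
  have "integrable (lebesgue_on Lam) (\<lambda>y. c\<^sup>2 + (v y)\<^sup>2 - 2 * c * v y)"
    using square_integrableD(2) [OF assms] square_integrable_imp_integrable [OF assms] by simp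
  thus ?thesis unfolding square_integrable_def by (simp add: power2_diff)
qed

lemma integrable_diff_square:
  assumes "square_integrable v"
  shows "integrable (lebesgue_on Lam \<Otimes>\<^sub>M lebesgue_on Lam) (\<lambda>z. (v (fst z) - v (snd z))\<^sup>2)"
proof (rule Lam2.Fubini_integrable)
  note m [measurable] = square_integrableD(1) [OF assms]
  note i = square_integrableD(2) [OF assms] square_integrable_imp_integrable [OF assms]
  show "(\<lambda>z. (v (fst z) - v (snd z))\<^sup>2) \<in> borel_measurable (lebesgue_on Lam \<Otimes>\<^sub>M lebesgue_on Lam)"
    by measurable
  show "AE x in lebesgue_on Lam. integrable (lebesgue_on Lam) (\<lambda>y. (v (fst (x, y)) - v (snd (x, y)))\<^sup>2)"
    using square_integrableD(2) [OF square_integrable_const_diff [OF assms]] by simp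
  have "(LINT y|lebesgue_on Lam. (v x - v y)\<^sup>2)
      = measure (lebesgue_on Lam) Lam * (v x)\<^sup>2 + (LINT y|lebesgue_on Lam. (v y)\<^sup>2)
        - 2 * v x * (LINT y|lebesgue_on Lam. v y)" for x
    using i by (simp add: power2_diff)
  thus "integrable (lebesgue_on Lam) (\<lambda>x. LINT y|lebesgue_on Lam. norm ((v (fst (x, y)) - v (snd (x, y)))\<^sup>2))"
    using i by simp
qed

lemma integrable_indicator_Lam:
  assumes "A \<in> sets (lebesgue_on Lam)"
  shows "integrable (lebesgue_on Lam) (indicator A :: real \<Rightarrow> real)"
  using assms by (rule integrable_real_indicator) (metis Lam.emeasure_finite infinity_ennreal_def less_top)

text \<open>Cauchy-Schwarz for f and the constant 1 on A, from the nonnegativity of the quadratic t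
  -> integral of (f - t)^2 over A.\<close>

lemma integral_indicator_square_le:
  assumes f: "square_integrable f" and A: "A \<in> sets (lebesgue_on Lam)"
  shows "(LINT x|lebesgue_on Lam. indicator A x * f x)\<^sup>2
    \<le> measure (lebesgue_on Lam) A * (LINT x|lebesgue_on Lam. indicator A x * (f x)\<^sup>2)" (is "?J\<^sup>2 \<le> ?m * ?Q")
proof -
  note i = integrable_real_mult_indicator [OF A square_integrableD(2) [OF f]]
    integrable_real_mult_indicator [OF A square_integrable_imp_integrable [OF f]]
  have iA: "integrable (lebesgue_on Lam) (indicator A :: real \<Rightarrow> real)"
    by (rule integrable_indicator_Lam [OF A])
  have quad: "0 \<le> ?Q - 2 * t * ?J + t\<^sup>2 * ?m" for t
  proof -
    have "0 \<le> (LINT x|lebesgue_on Lam. indicator A x * (f x - t)\<^sup>2)"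
      by (intro integral_nonneg_AE) auto
    also have "\<dots> = (LINT x|lebesgue_on Lam. indicator A x * (f x)\<^sup>2 - 2 * t * (indicator A x * f x)
        + t\<^sup>2 * indicator A x)"
      by (simp add: power2_diff algebra_simps)
    also have "\<dots> = ?Q - 2 * t * ?J + t\<^sup>2 * ?m"
      using i iA sets.sets_into_space [OF A] by (simp add: mult.commute [of _ "indicator A _"] Int_absorb2)
    finally show ?thesis .
  qed
  show ?thesis
  proof (cases "?m = 0")
    case True
    have "?J = 0"
    proof (rule ccontr)
      assume "?J \<noteq> 0"
      \<comment> \<open>For measure 0 the quadratic is affine in t; this t gives it the value
        -1.\<close>
      thus False using quad [of "(?Q + 1) / (2 * ?J)"] True by (simp add: field_simps)
    qed
    thus ?thesis using True by simp
  next
    case False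
    hence "?m > 0" by (simp add: zero_less_measure_iff less_le)
    \<comment> \<open>The value \<open>t = ?J / ?m\<close> minimises the quadratic.\<close>
    have "0 \<le> ?m * (?Q - 2 * (?J / ?m) * ?J + (?J / ?m)\<^sup>2 * ?m)"
      by (rule mult_nonneg_nonneg [OF less_imp_le [OF \<open>?m > 0\<close>] quad])
    also have "\<dots> = ?m * ?Q - ?J\<^sup>2" using \<open>?m > 0\<close> by (simp add: field_simps power2_eq_square)
    finally show ?thesis by simp
  qed
qed

section \<open>Estimates on a subinterval\<close>

lemma Ioc_sets_Lam: "{a<..b} \<in> sets (lebesgue_on Lam)" if "-1 \<le> a" "b \<le> 1" for a b :: real
  using that by (subst sets_restrict_space_iff) auto

lemma measure_Ioc_Lam: "measure (lebesgue_on Lam) {a<..b} = b - a" if "-1 \<le> a" "a \<le> b" "b \<le> 1" for a b :: real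
  using that by (subst measure_restrict_space) auto

text \<open>The constant is chosen before the interval because every \<psi> is a rescaling of one
  bump: \<psi> is bounded by K/h and \<psi>' by K/h^2. The double integral is kept as it is, since
  the fractional and the second order case bound it in different ways.\<close>

lemma local_estimate:
  obtains K where "K > 0"
    "\<And>u v a h. square_integrable u \<Longrightarrow> square_integrable v \<Longrightarrow> is_weak_deriv 1 u v \<Longrightarrow>
       -1 \<le> a \<Longrightarrow> h > 0 \<Longrightarrow> a + h \<le> 1 \<Longrightarrow>
       (LINT x|lebesgue_on Lam. indicator {a<..a+h} x * (v x)\<^sup>2)
       \<le> K * ((LINT x|lebesgue_on Lam. indicator {a<..a+h} x * (u x)\<^sup>2) / h\<^sup>2
            + (LINT z|(lebesgue_on Lam \<Otimes>\<^sub>M lebesgue_on Lam).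
                 indicator ({a<..a+h} \<times> {a<..a+h}) z * (v (fst z) - v (snd z))\<^sup>2) / h)"
proof -
  obtain \<eta> K where \<eta>: "smooth \<eta>" "\<And>x. x \<notin> {1/4..3/4} \<Longrightarrow> \<eta> x = 0" "(LINT x|lebesgue_on Lam. \<eta> x) = 1"
    and K: "K > 0" "\<And>x. \<bar>\<eta> x\<bar> \<le> K" "\<And>x. \<bar>deriv \<eta> x\<bar> \<le> K"
    using unit_bump by metis
  show ?thesis
  \<comment> \<open>K^2 comes from the bounds on \<psi> and \<psi>', and the 2 from splitting the
    square of v = A + (v - A).\<close>
  proof (rule that [of "2 * K\<^sup>2"])
    fix u v :: "real \<Rightarrow> real" and a h :: real
    assume u: "square_integrable u" and v: "square_integrable v" and uv: "is_weak_deriv 1 u v"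
      and ah: "-1 \<le> a" "h > 0" "a + h \<le> 1"
    define I where "I = {a<..a+h}"
    have I: "I \<in> sets (lebesgue_on Lam)" unfolding I_def using ah by (intro Ioc_sets_Lam) auto
    have mI: "measure (lebesgue_on Lam) I = h" unfolding I_def using ah by (subst measure_Ioc_Lam) auto
    have IL: "I \<subseteq> Lam" using ah by (auto simp: I_def)
    note m [measurable] = I square_integrableD(1) [OF u] square_integrableD(1) [OF v]
    \<comment> \<open>\<psi>(y) = \<eta>((y - a) / h) / h; the division by h preserves unit
      mass.\<close>
    define \<psi> where "\<psi> y = (1/h) * \<eta> ((1/h) * y + (- (a/h)))" for y
    define \<psi>' where "\<psi>' y = (1/h) * (deriv \<eta> ((1/h) * y + (- (a/h))) * (1/h))" for y
    have sm: "smooth \<psi>" unfolding \<psi>_def by (intro smooth_cmult smooth_affine \<eta>)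
    have d: "(\<psi> has_real_derivative \<psi>' y) (at y)" for y
    proof -
      have "((\<lambda>y. c * y + e) has_real_derivative c) (at y)" for c e :: real
        by (auto intro!: derivative_eq_intros)
      from this [of "1/h" "- (a/h)"]
      have "((\<lambda>y. (1/h) * y + (- (a/h))) has_real_derivative (1/h)) (at y)" .
      from DERIV_cmult [OF DERIV_chain2 [OF smooth_has_deriv [OF \<eta>(1)] this], where c = "1/h"]
      show ?thesis unfolding \<psi>_def \<psi>'_def .
    qed
    have d': "deriv \<psi> = \<psi>'" using d by (auto intro!: DERIV_imp_deriv)
    have arg: "(1/h) * y + (- (a/h)) = (y - a) / h" for y by (simp add: diff_divide_distrib)
    have out: "\<psi> y = 0" if "y \<notin> {a + h/4..a + 3*h/4}" for y
    proof -
      have "(y - a) / h \<notin> {1/4..3/4}" using that ah by (auto simp: field_simps)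
      thus ?thesis unfolding \<psi>_def arg by (simp add: \<eta>(2))
    qed
    have outI: "\<psi> y = 0" "\<psi>' y = 0" if "y \<notin> I" for y
    proof -
      have y: "y \<notin> {a + h/4..a + 3*h/4}" using that ah by (auto simp: I_def)
      show "\<psi> y = 0" by (rule out [OF y])
      show "\<psi>' y = 0" using deriv_eq_0_outside [of _ _ \<psi>, OF out y] d' by simp
    qed
    have t: "test_function \<psi>"
      by (rule test_functionI [OF sm _ _ out]) (use ah in auto)
    have t': "test_function \<psi>'" using test_function_deriv [OF t] d' by simp
    have b: "\<bar>\<psi> y\<bar> \<le> K / h" for y
      using K(2) ah by (simp add: \<psi>_def abs_mult field_simps)
    have b': "\<bar>\<psi>' y\<bar> \<le> K / h\<^sup>2" for y
      using K(3) ah by (simp add: \<psi>'_def abs_mult field_simps power2_eq_square)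
    have int1: "(LINT y|lebesgue_on Lam. \<psi> y) = 1"
    proof -
      have "1 = (LINT x|lebesgue. \<eta> x)"
        using \<eta>(2,3) by (subst LINT_Lam_eq_lebesgue [symmetric]) auto
      also have "\<dots> = \<bar>1/h\<bar> *\<^sub>R (LINT x|lebesgue. \<eta> (- (a/h) + (1/h) * x))"
        using ah by (intro lebesgue_integral_real_affine) auto
      also have "\<dots> = (LINT y|lebesgue. \<psi> y)"
        using ah by (simp add: \<psi>_def add.commute)
      also have "\<dots> = (LINT y|lebesgue_on Lam. \<psi> y)"
        using IL by (intro LINT_Lam_eq_lebesgue [symmetric] outI(1)) blast
      finally show ?thesis by simp
    qed
    define A where "A = (LINT y|lebesgue_on Lam. v y * \<psi> y)"
    define U where "U = (LINT x|lebesgue_on Lam. indicator I x * (u x)\<^sup>2)"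
    have sq\<psi>: "(indicator I y * (w y * \<psi> y)) = w y * \<psi> y" for w :: "real \<Rightarrow> real" and y
      using outI [of y] by (auto simp: indicator_def)
    have sq\<psi>': "(indicator I y * (w y * \<psi>' y)) = w y * \<psi>' y" for w :: "real \<Rightarrow> real" and y
      using outI [of y] by (auto simp: indicator_def)
    \<comment> \<open>A is the \<psi>-average of v. The weak derivative moves to \<psi>', and
      Cauchy-Schwarz on an interval of length h costs one factor h.\<close>
    have A2: "A\<^sup>2 \<le> h * ((K / h\<^sup>2)\<^sup>2 * U)"
    proof -
      have "A = - (LINT y|lebesgue_on Lam. u y * \<psi>' y)"
        using is_weak_derivD(3) [OF uv t] by (simp add: A_def d')
      hence "A\<^sup>2 = (LINT y|lebesgue_on Lam. indicator I y * (u y * \<psi>' y))\<^sup>2"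
        by (simp add: sq\<psi>')
      also have "\<dots> \<le> h * (LINT y|lebesgue_on Lam. indicator I y * (u y * \<psi>' y)\<^sup>2)"
        using integral_indicator_square_le [OF square_integrable_mult_bounded [OF u test_function_measurable [OF t'] b'] I]
        by (simp add: mI)
      also have "(LINT y|lebesgue_on Lam. indicator I y * (u y * \<psi>' y)\<^sup>2)
          \<le> (LINT y|lebesgue_on Lam. (K / h\<^sup>2)\<^sup>2 * (indicator I y * (u y)\<^sup>2))"
      proof (rule integral_mono)
        show "integrable (lebesgue_on Lam) (\<lambda>y. indicator I y * (u y * \<psi>' y)\<^sup>2)"
          using integrable_real_mult_indicator [OF I square_integrableD(2) [OF
              square_integrable_mult_bounded [OF u test_function_measurable [OF t'] b']]]
          by (simp add: mult.commute)
        show "integrable (lebesgue_on Lam) (\<lambda>y. (K / h\<^sup>2)\<^sup>2 * (indicator I y * (u y)\<^sup>2))"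
          using integrable_real_mult_indicator [OF I square_integrableD(2) [OF u]]
          by (simp add: mult.commute)
        fix y
        have "(\<psi>' y)\<^sup>2 \<le> (K / h\<^sup>2)\<^sup>2" using b' [of y] by (metis abs_ge_zero power2_abs power_mono)
        hence "(u y)\<^sup>2 * (\<psi>' y)\<^sup>2 \<le> (u y)\<^sup>2 * (K / h\<^sup>2)\<^sup>2" by (intro mult_left_mono) auto
        thus "indicator I y * (u y * \<psi>' y)\<^sup>2 \<le> (K / h\<^sup>2)\<^sup>2 * (indicator I y * (u y)\<^sup>2)"
          by (simp add: power_mult_distrib indicator_def mult.commute)
      qed
      finally show ?thesis using ah by (simp add: U_def mult_left_mono)
    qed
    define D where "D z = indicator (I \<times> I) z * (v (fst z) - v (snd z))\<^sup>2" for z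
    have D: "integrable (lebesgue_on Lam \<Otimes>\<^sub>M lebesgue_on Lam) D"
      unfolding D_def using integrable_mult_indicator [OF _ integrable_diff_square [OF v], of "I \<times> I"] I
      by simp
    have iI: "integrable (lebesgue_on Lam) (\<lambda>x. indicator I x * (w x)\<^sup>2)" if "square_integrable w" for w
      using integrable_mult_indicator [OF I square_integrableD(2) [OF that]] by simp
    have pt: "indicator I x * (v x)\<^sup>2
        \<le> 2 * A\<^sup>2 * indicator I x + 2 * K\<^sup>2 / h * (LINT y|lebesgue_on Lam. D (x, y))" for x
    proof (cases "x \<in> I")
      case True
      define w where "w y = v x - v y" for y
      have w: "square_integrable w" unfolding w_def by (rule square_integrable_const_diff [OF v])
      have "(LINT y|lebesgue_on Lam. w y * \<psi> y) = (LINT y|lebesgue_on Lam. v x * \<psi> y - v y * \<psi> y)"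
        by (simp add: w_def left_diff_distrib)
      also have "\<dots> = v x - A"
        using integrable_test_function [OF t] int1
          integrable_times_test_function [OF is_weak_derivD(2) [OF uv] t] by (simp add: A_def)
      finally have "(v x - A)\<^sup>2 = (LINT y|lebesgue_on Lam. indicator I y * (w y * \<psi> y))\<^sup>2"
        by (simp add: sq\<psi>)
      also have "\<dots> \<le> h * (LINT y|lebesgue_on Lam. indicator I y * (w y * \<psi> y)\<^sup>2)"
        using integral_indicator_square_le [OF square_integrable_mult_bounded [OF w test_function_measurable [OF t] b] I]
        by (simp add: mI)
      also have "(LINT y|lebesgue_on Lam. indicator I y * (w y * \<psi> y)\<^sup>2)
          \<le> (LINT y|lebesgue_on Lam. (K / h)\<^sup>2 * (indicator I y * (w y)\<^sup>2))"
      proof (rule integral_mono)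
        show "integrable (lebesgue_on Lam) (\<lambda>y. indicator I y * (w y * \<psi> y)\<^sup>2)"
          by (intro iI square_integrable_mult_bounded [OF w test_function_measurable [OF t] b])
        show "integrable (lebesgue_on Lam) (\<lambda>y. (K / h)\<^sup>2 * (indicator I y * (w y)\<^sup>2))"
          using iI [OF w] by simp
        fix y
        have "(\<psi> y)\<^sup>2 \<le> (K / h)\<^sup>2" using b [of y] by (metis abs_ge_zero power2_abs power_mono)
        hence "(w y)\<^sup>2 * (\<psi> y)\<^sup>2 \<le> (w y)\<^sup>2 * (K / h)\<^sup>2" by (intro mult_left_mono) auto
        thus "indicator I y * (w y * \<psi> y)\<^sup>2 \<le> (K / h)\<^sup>2 * (indicator I y * (w y)\<^sup>2)"
          by (simp add: power_mult_distrib indicator_def mult.commute)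
      qed
      also have "\<dots> = (K / h)\<^sup>2 * (LINT y|lebesgue_on Lam. D (x, y))"
        using True by (simp add: D_def w_def indicator_times)
      also have "h * ((K / h)\<^sup>2 * (LINT y|lebesgue_on Lam. D (x, y))) = K\<^sup>2 / h * (LINT y|lebesgue_on Lam. D (x, y))"
        using ah by (simp add: power2_eq_square)
      finally have 1: "(v x - A)\<^sup>2 \<le> K\<^sup>2 / h * (LINT y|lebesgue_on Lam. D (x, y))"
        using ah by (simp add: mult_left_mono)
      \<comment> \<open>This square is the difference of the two sides of the next
        inequality.\<close>
      have "0 \<le> (v x - 2 * A)\<^sup>2" by simp
      hence "(v x)\<^sup>2 \<le> 2 * A\<^sup>2 + 2 * (v x - A)\<^sup>2" by (simp add: power2_diff)
      thus ?thesis using 1 True by simp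
    qed (simp add: D_def)
    have "(LINT x|lebesgue_on Lam. indicator I x * (v x)\<^sup>2)
        \<le> (LINT x|lebesgue_on Lam. 2 * A\<^sup>2 * indicator I x + 2 * K\<^sup>2 / h * (LINT y|lebesgue_on Lam. D (x, y)))"
      using iI [OF v] Lam2.integrable_fst' [OF D] I
      by (intro integral_mono pt) (auto simp: integrable_indicator_Lam)
    also have "\<dots> = 2 * A\<^sup>2 * h + 2 * K\<^sup>2 / h * (LINT x|lebesgue_on Lam. LINT y|lebesgue_on Lam. D (x, y))"
      using Lam2.integrable_fst' [OF D] I mI IL
      by (subst Bochner_Integration.integral_add)
        (auto simp: integrable_indicator_Lam Int_absorb2)
    also have "(LINT x|lebesgue_on Lam. LINT y|lebesgue_on Lam. D (x, y))
        = integral\<^sup>L (lebesgue_on Lam \<Otimes>\<^sub>M lebesgue_on Lam) D"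
      by (rule Lam2.integral_fst' [OF D])
    also have "2 * A\<^sup>2 * h \<le> 2 * (h * ((K / h\<^sup>2)\<^sup>2 * U)) * h"
      using A2 ah by (intro mult_right_mono mult_left_mono) auto
    also have "\<dots> = 2 * K\<^sup>2 * (U / h\<^sup>2)"
      using ah by (simp add: field_simps power2_eq_square)
    finally show "(LINT x|lebesgue_on Lam. indicator {a<..a+h} x * (v x)\<^sup>2)
       \<le> 2 * K\<^sup>2 * ((LINT x|lebesgue_on Lam. indicator {a<..a+h} x * (u x)\<^sup>2) / h\<^sup>2
            + (LINT z|(lebesgue_on Lam \<Otimes>\<^sub>M lebesgue_on Lam).
                 indicator ({a<..a+h} \<times> {a<..a+h}) z * (v (fst z) - v (snd z))\<^sup>2) / h)"
      unfolding I_def U_def D_def by (simp add: distrib_left)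
  qed (use K in auto)
qed

section \<open>Interpolation inequalities\<close>

lemma L2_norm_nonneg: "0 \<le> L2_norm u"
  by (simp add: L2_norm_def integral_nonneg_AE)

lemma L2_norm_square: "(L2_norm u)\<^sup>2 = (LINT x|lebesgue_on Lam. (u x)\<^sup>2)"
  by (simp add: L2_norm_def integral_nonneg_AE)

text \<open>Half-open tiles are disjoint and leave no gap, so the indicators add up exactly at every
  point.\<close>

lemma sum_indicator_Ioc:
  fixes a h x :: real
  assumes "h \<ge> 0"
  shows "(\<Sum>i<n. indicator {a + real i * h<..a + real i * h + h} x) = (indicator {a<..a + real n * h} x :: real)"
proof (induction n)
  case (Suc n)
  define q where "q = real n * h"
  have "q \<ge> 0" "real (Suc n) * h = q + h" using assms by (auto simp: q_def algebra_simps)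
  thus ?case using assms
    unfolding sum.lessThan_Suc Suc.IH q_def [symmetric] by (auto simp: indicator_def)
qed simp

lemma partition_nodes:
  assumes "n \<ge> 1" "i < n"
  shows "-1 \<le> -1 + real i * (2 / real n)" "-1 + real i * (2 / real n) + 2 / real n \<le> 1"
proof -
  have "real i + 1 \<le> real n" using assms by linarith
  hence "(real i + 1) * (2 / real n) \<le> real n * (2 / real n)" by (intro mult_right_mono) auto
  thus "-1 + real i * (2 / real n) + 2 / real n \<le> 1"
    using assms by (simp add: distrib_right add_divide_distrib)
qed simp

text \<open>Sums the local estimate over n tiles of length 2/n. The bound \<open>B\<close> on the
  local double integrals is a parameter, to be filled in separately by the fractional and the second
  order case.\<close>

lemma global_estimate:
  obtains K where "K > 0"
    "\<And>u v n B. square_integrable u \<Longrightarrow> square_integrable v \<Longrightarrow> is_weak_deriv 1 u v \<Longrightarrow> n \<ge> 1 \<Longrightarrow>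
       (\<And>a. -1 \<le> a \<Longrightarrow> a + 2 / real n \<le> 1 \<Longrightarrow>
          (LINT z|(lebesgue_on Lam \<Otimes>\<^sub>M lebesgue_on Lam).
             indicator ({a<..a + 2 / real n} \<times> {a<..a + 2 / real n}) z * (v (fst z) - v (snd z))\<^sup>2) \<le> B a) \<Longrightarrow>
       (L2_norm v)\<^sup>2 \<le> K * ((L2_norm u)\<^sup>2 / (2 / real n)\<^sup>2
          + (\<Sum>i<n. B (-1 + real i * (2 / real n))) / (2 / real n))"
proof -
  obtain K where K: "K > 0"
    "\<And>u v a h. square_integrable u \<Longrightarrow> square_integrable v \<Longrightarrow> is_weak_deriv 1 u v \<Longrightarrow>
       -1 \<le> a \<Longrightarrow> h > 0 \<Longrightarrow> a + h \<le> 1 \<Longrightarrow>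
       (LINT x|lebesgue_on Lam. indicator {a<..a+h} x * (v x)\<^sup>2)
       \<le> K * ((LINT x|lebesgue_on Lam. indicator {a<..a+h} x * (u x)\<^sup>2) / h\<^sup>2
            + (LINT z|(lebesgue_on Lam \<Otimes>\<^sub>M lebesgue_on Lam).
                 indicator ({a<..a+h} \<times> {a<..a+h}) z * (v (fst z) - v (snd z))\<^sup>2) / h)"
    by (fact local_estimate)
  show ?thesis
  proof (rule that [OF K(1)])
    fix u v :: "real \<Rightarrow> real" and n :: nat and B :: "real \<Rightarrow> real"
    assume u: "square_integrable u" and v: "square_integrable v" and uv: "is_weak_deriv 1 u v" and n: "n \<ge> 1"
      and B: "\<And>a. -1 \<le> a \<Longrightarrow> a + 2 / real n \<le> 1 \<Longrightarrow>
          (LINT z|(lebesgue_on Lam \<Otimes>\<^sub>M lebesgue_on Lam).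
             indicator ({a<..a + 2 / real n} \<times> {a<..a + 2 / real n}) z * (v (fst z) - v (snd z))\<^sup>2) \<le> B a"
    define h where "h = 2 / real n"
    define a where "a i = -1 + real i * h" for i
    have h: "h > 0" "real n * h = 2" using n by (auto simp: h_def)
    note ai = partition_nodes [OF n, folded h_def a_def]
    have split: "(L2_norm w)\<^sup>2 = (\<Sum>i<n. LINT x|lebesgue_on Lam. indicator {a i<..a i + h} x * (w x)\<^sup>2)"
      if w: "square_integrable w" for w
    proof -
      have "(LINT x|lebesgue_on Lam. (w x)\<^sup>2)
          = (LINT x|lebesgue_on Lam. (\<Sum>i<n. indicator {a i<..a i + h} x * (w x)\<^sup>2))"
      proof (rule integral_cong_AE)
        \<comment> \<open>The tiles cover (-1,1], that is, all of [-1,1] but one point.\<close>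
        have "AE x in lebesgue. x \<noteq> (-1::real)" by (intro AE_completion AE_lborel_singleton)
        hence "AE x in lebesgue_on Lam. x \<noteq> -1" by (subst AE_restrict_space_iff) auto
        thus "AE x in lebesgue_on Lam. (w x)\<^sup>2 = (\<Sum>i<n. indicator {a i<..a i + h} x * (w x)\<^sup>2)"
          using AE_space
        proof eventually_elim
          case (elim x)
          have "(\<Sum>i<n. indicator {a i<..a i + h} x) = (indicator {-1<..-1 + real n * h} x :: real)"
            unfolding a_def using h by (intro sum_indicator_Ioc) auto
          also have "\<dots> = 1" using elim h by auto
          finally show ?case by (simp flip: sum_distrib_right)
        qed
        have "{a i<..a i + h} \<in> sets (lebesgue_on Lam)" if "i < n" for i
          using ai [OF that] by (rule Ioc_sets_Lam)
        thus "(\<lambda>x. \<Sum>i<n. indicator {a i<..a i + h} x * (w x)\<^sup>2) \<in> borel_measurable (lebesgue_on Lam)"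
          using square_integrableD(2) [OF w] by (intro borel_measurable_sum borel_measurable_times) auto
      qed (use square_integrableD(2) [OF w] in auto)
      also have "\<dots> = (\<Sum>i<n. LINT x|lebesgue_on Lam. indicator {a i<..a i + h} x * (w x)\<^sup>2)"
        using integrable_mult_indicator [OF Ioc_sets_Lam [OF ai] square_integrableD(2) [OF w]]
        by (intro Bochner_Integration.integral_sum) auto
      finally show ?thesis by (simp add: L2_norm_square)
    qed
    have "(L2_norm v)\<^sup>2 \<le> (\<Sum>i<n. K * ((LINT x|lebesgue_on Lam. indicator {a i<..a i + h} x * (u x)\<^sup>2) / h\<^sup>2
        + B (a i) / h))"
      unfolding split [OF v]
    proof (rule sum_mono)
      fix i assume "i \<in> {..<n}"
      hence i: "-1 \<le> a i" "a i + h \<le> 1" using ai by auto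
      have "(LINT x|lebesgue_on Lam. indicator {a i<..a i+h} x * (v x)\<^sup>2)
       \<le> K * ((LINT x|lebesgue_on Lam. indicator {a i<..a i+h} x * (u x)\<^sup>2) / h\<^sup>2
            + (LINT z|(lebesgue_on Lam \<Otimes>\<^sub>M lebesgue_on Lam).
                 indicator ({a i<..a i+h} \<times> {a i<..a i+h}) z * (v (fst z) - v (snd z))\<^sup>2) / h)"
        by (rule K(2) [OF u v uv i(1) h(1) i(2)])
      also have "\<dots> \<le> K * ((LINT x|lebesgue_on Lam. indicator {a i<..a i+h} x * (u x)\<^sup>2) / h\<^sup>2 + B (a i) / h)"
        using B [folded h_def, OF i] K(1) h by (intro mult_left_mono add_left_mono divide_right_mono) auto
      finally show "(LINT x|lebesgue_on Lam. indicator {a i<..a i+h} x * (v x)\<^sup>2) \<le> \<dots>" .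
    qed
    also have "\<dots> = K * ((L2_norm u)\<^sup>2 / h\<^sup>2 + (\<Sum>i<n. B (a i)) / h)"
      by (simp only: split [OF u] sum_divide_distrib sum_distrib_left flip: sum.distrib)
    finally show "(L2_norm v)\<^sup>2 \<le> K * ((L2_norm u)\<^sup>2 / (2 / real n)\<^sup>2
          + (\<Sum>i<n. B (-1 + real i * (2 / real n))) / (2 / real n))"
      unfolding a_def h_def .
  qed
qed

text \<open>Tilings provide only the scales t = 2/n. Rounding 2/h up gives h/2 <= t <= h, so a/t at
  most doubles and t^p does not exceed h^p. The root is taken after bounding a sum of two squares by
  the square of the sum.\<close>

lemma from_partition_scales:
  fixes K a b p T h :: real
  assumes "K > 0" "a \<ge> 0" "T \<ge> 0" "p \<ge> 0" "0 < h" "h \<le> 1"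
    and le: "\<And>n::nat. n \<ge> 1 \<Longrightarrow> b\<^sup>2 \<le> K * (a\<^sup>2 / (2 / real n)\<^sup>2 + ((2 / real n) powr p * T)\<^sup>2)"
  shows "b \<le> 2 * sqrt K * (a / h + h powr p * T)"
proof -
  define n where "n = nat \<lceil>2 / h\<rceil>"
  define t where "t = 2 / real n"
  have 2: "2 / h \<ge> 2" using assms by (simp add: field_simps)
  have n1: "2 / h \<le> real n" unfolding n_def by linarith
  have n2: "real n \<le> 2 / h + 1" unfolding n_def using 2 by linarith
  have n: "n \<ge> 1" using n1 2 by linarith
  have t: "t > 0" "t \<le> h" using n n1 assms by (auto simp: t_def field_simps)
  have "real n \<le> 4 / h" using n2 2 by simp
  hence t2: "h / 2 \<le> t" using n assms by (simp add: t_def field_simps)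
  have "a / t \<le> a / (h / 2)" using assms t2 t by (intro divide_left_mono) auto
  hence 1: "a / t \<le> 2 * (a / h)" by (simp add: mult.commute)
  have 3: "t powr p * T \<le> h powr p * T" using t assms by (intro mult_right_mono powr_mono2) auto
  have nn: "a / t \<ge> 0" "t powr p * T \<ge> 0" using t assms by auto
  have "b\<^sup>2 \<le> K * ((a / t)\<^sup>2 + (t powr p * T)\<^sup>2)"
    using le [OF n] by (simp add: t_def power_divide power_mult_distrib)
  also have "\<dots> \<le> K * (a / t + t powr p * T)\<^sup>2"
  proof (rule mult_left_mono)
    have "p\<^sup>2 + q\<^sup>2 \<le> (p + q)\<^sup>2" if "p \<ge> 0" "q \<ge> 0" for p q :: real
      using that by (simp add: power2_sum)
    thus "(a / t)\<^sup>2 + (t powr p * T)\<^sup>2 \<le> (a / t + t powr p * T)\<^sup>2" using nn by blast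
  qed (use assms in simp)
  also have "\<dots> \<le> K * (2 * (a / h + h powr p * T))\<^sup>2"
  proof (intro mult_left_mono power_mono)
    show "a / t + t powr p * T \<le> 2 * (a / h + h powr p * T)"
      using 1 3 nn unfolding distrib_left by linarith
  qed (use assms nn in auto)
  also have "\<dots> = (2 * sqrt K * (a / h + h powr p * T))\<^sup>2"
    using assms by (simp add: power_mult_distrib del: distrib_left_numeral)
  finally show ?thesis
    by (rule power2_le_imp_le) (use assms(1-6) in simp)
qed

text \<open>Two points of a tile of length t are at distance at most t, so (v(x) - v(y))^2 is at
  most t^(1+2s) times the Gagliardo quotient. The squares over the tiles are disjoint, so their
  contributions add up to at most the full double integral; the division by t leaves t^(2s).\<close>

lemma interpolation_fractional:
  assumes s: "0 < s" "s < 1"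
  obtains C where "C > 0"
    "\<And>u v h. square_integrable u \<Longrightarrow> square_integrable v \<Longrightarrow> is_weak_deriv 1 u v \<Longrightarrow>
       integrable (lebesgue_on Lam \<Otimes>\<^sub>M lebesgue_on Lam) (gagliardo_quot s v) \<Longrightarrow> 0 < h \<Longrightarrow> h \<le> 1 \<Longrightarrow>
       L2_norm v \<le> C * (L2_norm u / h + h powr s *
         sqrt (LINT z|(lebesgue_on Lam \<Otimes>\<^sub>M lebesgue_on Lam). gagliardo_quot s v z))"
proof -
  let ?LL = "lebesgue_on Lam \<Otimes>\<^sub>M lebesgue_on Lam"
  obtain K where K: "K > 0"
    "\<And>u v n B. square_integrable u \<Longrightarrow> square_integrable v \<Longrightarrow> is_weak_deriv 1 u v \<Longrightarrow> n \<ge> 1 \<Longrightarrow>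
       (\<And>a. -1 \<le> a \<Longrightarrow> a + 2 / real n \<le> 1 \<Longrightarrow>
          (LINT z|?LL. indicator ({a<..a + 2 / real n} \<times> {a<..a + 2 / real n}) z * (v (fst z) - v (snd z))\<^sup>2) \<le> B a) \<Longrightarrow>
       (L2_norm v)\<^sup>2 \<le> K * ((L2_norm u)\<^sup>2 / (2 / real n)\<^sup>2
          + (\<Sum>i<n. B (-1 + real i * (2 / real n))) / (2 / real n))"
    by (fact global_estimate)
  show ?thesis
  proof (rule that [of "2 * sqrt K"])
    fix u v h
    assume u: "square_integrable u" and v: "square_integrable v" and uv: "is_weak_deriv 1 u v"
      and g: "integrable ?LL (gagliardo_quot s v)" and h: "0 < h" "h \<le> (1::real)"
    have gnn: "gagliardo_quot s v z \<ge> 0" for z by (auto simp: gagliardo_quot_def split: prod.split)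
    define G where "G = (LINT z|?LL. gagliardo_quot s v z)"
    have G: "G \<ge> 0" unfolding G_def using gnn by (intro integral_nonneg_AE) auto
    show "L2_norm v \<le> 2 * sqrt K * (L2_norm u / h + h powr s * sqrt (LINT z|?LL. gagliardo_quot s v z))"
      unfolding G_def [symmetric]
    proof (rule from_partition_scales)
      fix n :: nat assume n: "n \<ge> 1"
      define t where "t = 2 / real n"
      have t: "t > 0" using n by (simp add: t_def)
      define Q where "Q a = {a<..a + t} \<times> {a<..a + t}" for a :: real
      have Qs: "Q a \<in> sets ?LL" if "-1 \<le> a" "a + t \<le> 1" for a
        unfolding Q_def using that by (intro pair_measureI Ioc_sets_Lam) auto
      have Qi: "integrable ?LL (\<lambda>z. indicator (Q a) z * gagliardo_quot s v z)" if "-1 \<le> a" "a + t \<le> 1" for a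
        using integrable_mult_indicator [OF Qs [OF that] g] by simp
      define B where "B a = t powr (1 + 2 * s) * (LINT z|?LL. indicator (Q a) z * gagliardo_quot s v z)" for a
      have "(L2_norm v)\<^sup>2 \<le> K * ((L2_norm u)\<^sup>2 / (2 / real n)\<^sup>2
          + (\<Sum>i<n. B (-1 + real i * (2 / real n))) / (2 / real n))"
      proof (rule K(2) [OF u v uv n], fold t_def)
        fix a assume a: "-1 \<le> a" "a + t \<le> 1"
        have "(LINT z|?LL. indicator (Q a) z * (v (fst z) - v (snd z))\<^sup>2)
            \<le> (LINT z|?LL. t powr (1 + 2 * s) * (indicator (Q a) z * gagliardo_quot s v z))"
        proof (rule integral_mono)
          show "integrable ?LL (\<lambda>z. indicator (Q a) z * (v (fst z) - v (snd z))\<^sup>2)"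
            using integrable_mult_indicator [OF Qs [OF a] integrable_diff_square [OF v]] by simp
          show "integrable ?LL (\<lambda>z. t powr (1 + 2 * s) * (indicator (Q a) z * gagliardo_quot s v z))"
            using Qi [OF a] by simp
          fix z :: "real \<times> real"
          obtain x y where z: "z = (x, y)" by force
          show "indicator (Q a) z * (v (fst z) - v (snd z))\<^sup>2
              \<le> t powr (1 + 2 * s) * (indicator (Q a) z * gagliardo_quot s v z)"
          \<comment> \<open>On the diagonal both sides are 0: the increment vanishes, and so does
            the quotient as 0 / 0 = 0.\<close>
          proof (cases "z \<in> Q a \<and> x \<noteq> y")
            case True
            hence xy: "\<bar>x - y\<bar> > 0" "\<bar>x - y\<bar> \<le> t" by (auto simp: z Q_def)
            have "(v x - v y)\<^sup>2 = \<bar>x - y\<bar> powr (1 + 2 * s) * ((v x - v y)\<^sup>2 / \<bar>x - y\<bar> powr (1 + 2 * s))"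
              using xy by simp
            also have "\<dots> \<le> t powr (1 + 2 * s) * ((v x - v y)\<^sup>2 / \<bar>x - y\<bar> powr (1 + 2 * s))"
              using xy s by (intro mult_right_mono powr_mono2) auto
            finally show ?thesis using True by (simp add: z gagliardo_quot_def)
          qed (auto simp: z gagliardo_quot_def)
        qed
        thus "(LINT z|?LL. indicator ({a<..a + t} \<times> {a<..a + t}) z * (v (fst z) - v (snd z))\<^sup>2) \<le> B a"
          by (simp add: B_def Q_def)
      qed
      also have "(\<Sum>i<n. B (-1 + real i * (2 / real n))) \<le> t powr (1 + 2 * s) * G"
      proof -
        define b where "b i = -1 + real i * t" for i
        note b = partition_nodes [OF n, folded t_def b_def]
        have "(\<Sum>i<n. LINT z|?LL. indicator (Q (b i)) z * gagliardo_quot s v z)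
            = (LINT z|?LL. (\<Sum>i<n. indicator (Q (b i)) z * gagliardo_quot s v z))"
          using Qi [OF b] by (intro Bochner_Integration.integral_sum [symmetric]) auto
        also have "\<dots> \<le> G" unfolding G_def
        proof (rule integral_mono [OF _ g])
          show "integrable ?LL (\<lambda>z. \<Sum>i<n. indicator (Q (b i)) z * gagliardo_quot s v z)"
            using Qi [OF b] by (intro Bochner_Integration.integrable_sum) auto
          fix z :: "real \<times> real"
          \<comment> \<open>Each square lies in the vertical strip over its tile, and the strips are
            disjoint.\<close>
          have "(\<Sum>i<n. indicator (Q (b i)) z) \<le> (\<Sum>i<n. indicator {b i<..b i + t} (fst z) :: real)"
            by (intro sum_mono) (auto simp: indicator_def Q_def)
          also have "\<dots> = indicator {-1<..-1 + real n * t} (fst z)"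
            unfolding b_def using t by (intro sum_indicator_Ioc) auto
          also have "\<dots> \<le> 1" by (simp add: indicator_def)
          finally have "(\<Sum>i<n. indicator (Q (b i)) z) * gagliardo_quot s v z \<le> 1 * gagliardo_quot s v z"
            using gnn by (intro mult_right_mono) auto
          thus "(\<Sum>i<n. indicator (Q (b i)) z * gagliardo_quot s v z) \<le> gagliardo_quot s v z"
            by (simp add: sum_distrib_right)
        qed
        finally show ?thesis
          by (simp add: B_def b_def t_def mult_left_mono flip: sum_distrib_left)
      qed
      also have "t powr (1 + 2 * s) * G / (2 / real n) = (t powr s * sqrt G)\<^sup>2"
      proof -
        have "t powr (1 + 2 * s) = t * (t powr s * t powr s)"
          using t by (simp add: powr_add powr_add [symmetric] powr_one)
        thus ?thesis using t G by (simp add: power_mult_distrib power2_eq_square flip: t_def)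
      qed
      finally show "(L2_norm v)\<^sup>2 \<le> K * ((L2_norm u)\<^sup>2 / (2 / real n)\<^sup>2 + ((2 / real n) powr s * sqrt G)\<^sup>2)"
        using K(1) n by (simp add: t_def mult_left_mono divide_right_mono)
    qed (use K(1) G h s L2_norm_nonneg in auto)
  qed (use K(1) in simp)
qed

lemma primitive_diff_square_le:
  assumes w: "square_integrable w" and "-1 \<le> a" "h > 0" "a + h \<le> 1" "x \<in> {a<..a+h}" "y \<in> {a<..a+h}"
  shows "(primitive w x - primitive w y)\<^sup>2 \<le> h * (LINT z|lebesgue_on Lam. indicator {a<..a+h} z * (w z)\<^sup>2)"
proof -
  have *: "(primitive w x - primitive w y)\<^sup>2 \<le> h * (LINT z|lebesgue_on Lam. indicator {a<..a+h} z * (w z)\<^sup>2)"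
    if xy: "y \<le> x" "x \<in> {a<..a+h}" "y \<in> {a<..a+h}" for x y
  proof -
    have S: "{y<..x} \<in> sets (lebesgue_on Lam)" "{a<..a+h} \<in> sets (lebesgue_on Lam)"
      using xy assms by (auto intro!: Ioc_sets_Lam)
    have i: "integrable (lebesgue_on Lam) (\<lambda>z. indicator A z * (w z)\<^sup>2)" if "A \<in> sets (lebesgue_on Lam)" for A
      using integrable_mult_indicator [OF that square_integrableD(2) [OF w]] by simp
    have "(primitive w x - primitive w y)\<^sup>2 = (LINT z|lebesgue_on Lam. indicator {y<..x} z * w z)\<^sup>2"
      by (simp add: primitive_diff [OF square_integrable_imp_integrable [OF w] xy(1)])
    also have "\<dots> \<le> (x - y) * (LINT z|lebesgue_on Lam. indicator {y<..x} z * (w z)\<^sup>2)"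
      using integral_indicator_square_le [OF w S(1)] measure_Ioc_Lam [of y x] xy assms by auto
    also have "\<dots> \<le> h * (LINT z|lebesgue_on Lam. indicator {a<..a+h} z * (w z)\<^sup>2)"
    proof (rule mult_mono)
      show "(LINT z|lebesgue_on Lam. indicator {y<..x} z * (w z)\<^sup>2)
          \<le> (LINT z|lebesgue_on Lam. indicator {a<..a+h} z * (w z)\<^sup>2)"
        by (rule integral_mono [OF i [OF S(1)] i [OF S(2)]])
          (use xy in \<open>auto simp: indicator_def\<close>)
    qed (use xy assms in \<open>auto intro!: integral_nonneg_AE\<close>)
    finally show ?thesis .
  qed
  show ?thesis
    using *[of y x] *[of x y] assms by (cases "y \<le> x") (auto simp: power2_commute [of "primitive w x"])
qed

text \<open>On a tile I of length t, Cauchy-Schwarz for the primitive bounds (v(x) - v(y))^2 by t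
  times the integral of w^2 over I. Integrating over I x I gives t^3, and the division by t in the
  global estimate leaves t^2.\<close>

lemma interpolation_second_order:
  obtains C where "C > 0"
    "\<And>u v w h. square_integrable u \<Longrightarrow> square_integrable v \<Longrightarrow> square_integrable w \<Longrightarrow>
       is_weak_deriv 1 u v \<Longrightarrow> is_weak_deriv 1 v w \<Longrightarrow> 0 < h \<Longrightarrow> h \<le> 1 \<Longrightarrow>
       L2_norm v \<le> C * (L2_norm u / h + h * L2_norm w)"
proof -
  let ?LL = "lebesgue_on Lam \<Otimes>\<^sub>M lebesgue_on Lam"
  obtain K where K: "K > 0"
    "\<And>u v n B. square_integrable u \<Longrightarrow> square_integrable v \<Longrightarrow> is_weak_deriv 1 u v \<Longrightarrow> n \<ge> 1 \<Longrightarrow>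
       (\<And>a. -1 \<le> a \<Longrightarrow> a + 2 / real n \<le> 1 \<Longrightarrow>
          (LINT z|?LL. indicator ({a<..a + 2 / real n} \<times> {a<..a + 2 / real n}) z * (v (fst z) - v (snd z))\<^sup>2) \<le> B a) \<Longrightarrow>
       (L2_norm v)\<^sup>2 \<le> K * ((L2_norm u)\<^sup>2 / (2 / real n)\<^sup>2
          + (\<Sum>i<n. B (-1 + real i * (2 / real n))) / (2 / real n))"
    by (fact global_estimate)
  show ?thesis
  proof (rule that [of "2 * sqrt K"])
    fix u v w h
    assume u: "square_integrable u" and v: "square_integrable v" and w: "square_integrable w"
      and uv: "is_weak_deriv 1 u v" and vw: "is_weak_deriv 1 v w" and h: "0 < h" "h \<le> (1::real)"
    obtain c where c: "AE x in lebesgue_on Lam. v x = c + primitive w x"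
      using weak_deriv_AE_primitive [OF vw square_integrable_imp_integrable [OF w]] by metis
    have "L2_norm v \<le> 2 * sqrt K * (L2_norm u / h + h powr 1 * L2_norm w)"
    proof (rule from_partition_scales)
      fix n :: nat assume n: "n \<ge> 1"
      define t where "t = 2 / real n"
      have t: "t > 0" using n by (simp add: t_def)
      define P where "P a = (LINT z|lebesgue_on Lam. indicator {a<..a+t} z * (w z)\<^sup>2)" for a
      have P0: "P a \<ge> 0" for a unfolding P_def by (intro integral_nonneg_AE) auto
      define B where "B a = t ^ 3 * P a" for a
      have iP: "integrable (lebesgue_on Lam) (\<lambda>z. indicator {a<..a+t} z * (w z)\<^sup>2)" if "-1 \<le> a" "a + t \<le> 1" for a
        using integrable_mult_indicator [OF Ioc_sets_Lam [OF that] square_integrableD(2) [OF w]] by simp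
      have "(L2_norm v)\<^sup>2 \<le> K * ((L2_norm u)\<^sup>2 / (2 / real n)\<^sup>2
          + (\<Sum>i<n. B (-1 + real i * (2 / real n))) / (2 / real n))"
      proof (rule K(2) [OF u v uv n], fold t_def)
        fix a assume a: "-1 \<le> a" "a + t \<le> 1"
        define I where "I = {a<..a+t}"
        have I: "I \<in> sets (lebesgue_on Lam)" unfolding I_def using a by (rule Ioc_sets_Lam)
        have mI: "measure (lebesgue_on Lam) (I \<inter> Lam) = t"
          using measure_Ioc_Lam [of a "a + t"] a t sets.sets_into_space [OF I] by (simp add: I_def Int_absorb2)
        have iI: "integrable (lebesgue_on Lam) (indicator I :: real \<Rightarrow> real)" by (rule integrable_indicator_Lam [OF I])
        define D where "D z = indicator (I \<times> I) z * (v (fst z) - v (snd z))\<^sup>2" for z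
        have D: "integrable ?LL D"
          unfolding D_def using integrable_mult_indicator [OF _ integrable_diff_square [OF v], of "I \<times> I"] I
          by simp
        \<comment> \<open>v equals \<open>c + primitive w\<close> only almost everywhere. In the
          iterated integral the exceptional set is discarded once for x and then, for fixed x, once
          for y.\<close>
        have "integral\<^sup>L ?LL D = (LINT x|lebesgue_on Lam. LINT y|lebesgue_on Lam. D (x, y))"
          by (rule Lam2.integral_fst' [OF D, symmetric])
        also have "\<dots> \<le> (LINT x|lebesgue_on Lam. indicator I x * (t * (t * P a)))"
        proof (rule integral_mono_AE)
          show "AE x in lebesgue_on Lam. (LINT y|lebesgue_on Lam. D (x, y)) \<le> indicator I x * (t * (t * P a))"
            using c
          proof eventually_elim
            case (elim x)
            have "(LINT y|lebesgue_on Lam. D (x, y)) \<le> (LINT y|lebesgue_on Lam. indicator I x * (indicator I y * (t * P a)))"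
            proof (cases "integrable (lebesgue_on Lam) (\<lambda>y. D (x, y))")
              case True
              show ?thesis
              proof (rule integral_mono_AE [OF True])
                show "AE y in lebesgue_on Lam. D (x, y) \<le> indicator I x * (indicator I y * (t * P a))"
                  using c
                proof eventually_elim
                  case (elim y)
                  show ?case
                  proof (cases "x \<in> I \<and> y \<in> I")
                    case True
                    have "(primitive w x - primitive w y)\<^sup>2 \<le> t * P a"
                      unfolding P_def using primitive_diff_square_le [OF w a(1) t a(2)] True by (simp add: I_def)
                    thus ?thesis using True elim \<open>v x = c + primitive w x\<close> by (simp add: D_def)
                  qed (auto simp: D_def)
                qed
              qed (use iI in simp)
            next
              \<comment> \<open>A slice that is not integrable has integral 0 by convention, and the
                right-hand side is nonnegative.\<close>
              case False
              have "(LINT y|lebesgue_on Lam. indicator I x * (indicator I y * (t * P a))) \<ge> 0"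
                using t P0 by (intro integral_nonneg_AE) auto
              thus ?thesis using False by (simp add: not_integrable_integral_eq)
            qed
            also have "\<dots> = indicator I x * (t * (t * P a))" using mI iI by simp
            finally show ?case .
          qed
        qed (use Lam2.integrable_fst' [OF D] iI in auto)
        also have "\<dots> = B a" using mI iI by (simp add: B_def power3_eq_cube)
        finally show "(LINT z|?LL. indicator ({a<..a + t} \<times> {a<..a + t}) z * (v (fst z) - v (snd z))\<^sup>2) \<le> B a"
          by (simp add: D_def [abs_def] I_def)
      qed
      also have "(\<Sum>i<n. B (-1 + real i * (2 / real n))) \<le> t ^ 3 * (L2_norm w)\<^sup>2"
      proof -
        define b where "b i = -1 + real i * t" for i
        note b = partition_nodes [OF n, folded t_def b_def]
        have "(\<Sum>i<n. P (b i)) = (LINT z|lebesgue_on Lam. (\<Sum>i<n. indicator {b i<..b i + t} z * (w z)\<^sup>2))"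
          unfolding P_def using iP [OF b] by (intro Bochner_Integration.integral_sum [symmetric]) auto
        also have "\<dots> \<le> (L2_norm w)\<^sup>2" unfolding L2_norm_square
        proof (rule integral_mono [OF _ square_integrableD(2) [OF w]])
          show "integrable (lebesgue_on Lam) (\<lambda>z. \<Sum>i<n. indicator {b i<..b i + t} z * (w z)\<^sup>2)"
            using iP [OF b] by (intro Bochner_Integration.integrable_sum) auto
          fix z :: real
          have "(\<Sum>i<n. indicator {b i<..b i + t} z) = (indicator {-1<..-1 + real n * t} z :: real)"
            unfolding b_def using t by (intro sum_indicator_Ioc) auto
          also have "\<dots> \<le> 1" by (simp add: indicator_def)
          finally have "(\<Sum>i<n. indicator {b i<..b i + t} z) * (w z)\<^sup>2 \<le> 1 * (w z)\<^sup>2"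
            by (intro mult_right_mono) auto
          thus "(\<Sum>i<n. indicator {b i<..b i + t} z * (w z)\<^sup>2) \<le> (w z)\<^sup>2"
            by (simp add: sum_distrib_right)
        qed
        finally show ?thesis using t
          by (simp add: B_def b_def t_def mult_left_mono flip: sum_distrib_left)
      qed
      also have "t ^ 3 * (L2_norm w)\<^sup>2 / (2 / real n) = (t powr 1 * L2_norm w)\<^sup>2"
        using t by (simp add: power_mult_distrib power2_eq_square power3_eq_cube flip: t_def)
      finally show "(L2_norm v)\<^sup>2 \<le> K * ((L2_norm u)\<^sup>2 / (2 / real n)\<^sup>2 + ((2 / real n) powr 1 * L2_norm w)\<^sup>2)"
        using K(1) n by (simp add: t_def mult_left_mono divide_right_mono)
    qed (use K(1) h L2_norm_nonneg in auto)
    thus "L2_norm v \<le> 2 * sqrt K * (L2_norm u / h + h * L2_norm w)" using h by simp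
  qed (use K(1) in simp)
qed

section \<open>Arbitrary orders above 1\<close>

text \<open>The term of highest order r = k + s: for s = 0 it is the norm of the k-th derivative, so
  that integer and fractional orders share one induction.\<close>

definition top_seminorm :: "real \<Rightarrow> (real \<Rightarrow> real) \<Rightarrow> real" where
  "top_seminorm s v = (if s > 0
     then sqrt (LINT z|(lebesgue_on Lam \<Otimes>\<^sub>M lebesgue_on Lam). gagliardo_quot s v z) else L2_norm v)"

text \<open>Successive weak derivatives as a free sequence rather than as
  \<open>weak_deriv j u\<close>: dropping the first member leaves a chain again, whereas
  \<open>weak_deriv j (f 1)\<close> would be a new choice of representatives.\<close>

definition sobolev_chain :: "nat \<Rightarrow> real \<Rightarrow> (nat \<Rightarrow> real \<Rightarrow> real) \<Rightarrow> bool" where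
  "sobolev_chain k s f \<longleftrightarrow> (\<forall>j\<le>k. square_integrable (f j)) \<and> (\<forall>j<k. is_weak_deriv 1 (f j) (f (Suc j))) \<and>
     (s > 0 \<longrightarrow> integrable (lebesgue_on Lam \<Otimes>\<^sub>M lebesgue_on Lam) (gagliardo_quot s (f k)))"

lemma top_seminorm_nonneg: "top_seminorm s v \<ge> 0"
  by (auto simp: top_seminorm_def L2_norm_nonneg gagliardo_quot_def intro!: integral_nonneg_AE)

lemma interpolation_chain:
  assumes "k \<ge> 1" "0 \<le> s" "s < 1" "real k + s > 1"
  shows "\<exists>C>0. \<forall>f h. sobolev_chain k s f \<longrightarrow> 0 < h \<longrightarrow> h \<le> 1 \<longrightarrow>
    L2_norm (f 1) \<le> C * (L2_norm (f 0) / h + h powr (real k + s - 1) * top_seminorm s (f k))"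
  using assms(1,4)
proof (induction k rule: nat_induct_at_least)
  case base
  hence s: "s > 0" by simp
  obtain C where C: "C > 0"
    "\<And>u v h. square_integrable u \<Longrightarrow> square_integrable v \<Longrightarrow> is_weak_deriv 1 u v \<Longrightarrow>
       integrable (lebesgue_on Lam \<Otimes>\<^sub>M lebesgue_on Lam) (gagliardo_quot s v) \<Longrightarrow> 0 < h \<Longrightarrow> h \<le> 1 \<Longrightarrow>
       L2_norm v \<le> C * (L2_norm u / h + h powr s *
         sqrt (LINT z|(lebesgue_on Lam \<Otimes>\<^sub>M lebesgue_on Lam). gagliardo_quot s v z))"
    by (fact interpolation_fractional [OF s assms(3)])
  show ?case
  proof (intro exI [of _ C] conjI allI impI C(1))
    fix f h assume f: "sobolev_chain 1 s f" and h: "0 < h" "h \<le> (1::real)"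
    have "L2_norm (f 1) \<le> C * (L2_norm (f 0) / h + h powr s *
         sqrt (LINT z|(lebesgue_on Lam \<Otimes>\<^sub>M lebesgue_on Lam). gagliardo_quot s (f 1) z))"
      using f s h by (intro C(2)) (auto simp: sobolev_chain_def)
    thus "L2_norm (f 1) \<le> C * (L2_norm (f 0) / h + h powr (real 1 + s - 1) * top_seminorm s (f 1))"
      using s by (simp add: top_seminorm_def)
  qed
next
  case (Suc k)
  obtain C where C: "C > 0"
    "\<And>u v w h. square_integrable u \<Longrightarrow> square_integrable v \<Longrightarrow> square_integrable w \<Longrightarrow>
       is_weak_deriv 1 u v \<Longrightarrow> is_weak_deriv 1 v w \<Longrightarrow> 0 < h \<Longrightarrow> h \<le> 1 \<Longrightarrow>
       L2_norm v \<le> C * (L2_norm u / h + h * L2_norm w)"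
    by (fact interpolation_second_order)
  show ?case
  proof (cases "real k + s > 1")
    case False
    \<comment> \<open>Here the order \<open>Suc k + s\<close> is exactly 2, and the second order
      inequality is already the claim.\<close>
    hence k: "k = 1" "s = 0" using Suc.hyps assms(2) by auto
    show ?thesis
    proof (intro exI [of _ C] conjI allI impI C(1))
      fix f h assume f: "sobolev_chain (Suc k) s f" and h: "0 < h" "h \<le> (1::real)"
      have "L2_norm (f 1) \<le> C * (L2_norm (f 0) / h + h * L2_norm (f 2))"
        using f h k by (intro C(2)) (auto simp: sobolev_chain_def numeral_2_eq_2)
      thus "L2_norm (f 1) \<le> C * (L2_norm (f 0) / h + h powr (real (Suc k) + s - 1) * top_seminorm s (f (Suc k)))"
        using k h by (simp add: top_seminorm_def numeral_2_eq_2)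
    qed
  next
    case True
    from Suc.IH [OF True] obtain C' where C': "C' > 0" "\<And>f h. sobolev_chain k s f \<Longrightarrow> 0 < h \<Longrightarrow> h \<le> 1 \<Longrightarrow>
      L2_norm (f 1) \<le> C' * (L2_norm (f 0) / h + h powr (real k + s - 1) * top_seminorm s (f k))"
      by blast
    \<comment> \<open>Apply the second order inequality at scale \<open>\<delta> h\<close>: for this \<open>\<delta>\<close> the first derivative,
      which reappears when the second one is estimated by induction, can be absorbed on the left.\<close>
    define \<delta> where "\<delta> = min 1 (1 / (2 * C * C'))"
    have \<delta>: "\<delta> > 0" "\<delta> \<le> 1" using C(1) C'(1) by (auto simp: \<delta>_def)
    have "\<delta> \<le> 1 / (2 * C * C')" by (simp add: \<delta>_def)
    hence \<delta>C: "C * (\<delta> * C') \<le> 1 / 2" using C(1) C'(1) by (simp add: field_simps)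
    show ?thesis
    \<comment> \<open>\<open>2 * C / \<delta>\<close> is the coefficient of the lowest term after
      absorption has doubled it; the 1 covers the top term.\<close>
    proof (intro exI [of _ "2 * C / \<delta> + 1"] conjI allI impI)
      show "2 * C / \<delta> + 1 > 0" using C(1) \<delta> by (simp add: add_pos_pos)
      fix f h assume f: "sobolev_chain (Suc k) s f" and h: "0 < h" "h \<le> (1::real)"
      let ?a0 = "L2_norm (f 0)" and ?a1 = "L2_norm (f 1)" and ?a2 = "L2_norm (f 2)"
      let ?T = "top_seminorm s (f (Suc k))" and ?p = "real k + s - 1"
      have "?a1 \<le> C * (?a0 / (\<delta> * h) + (\<delta> * h) * ?a2)"
        using f h \<delta> Suc.hyps by (intro C(2)) (auto simp: sobolev_chain_def numeral_2_eq_2 mult_le_one)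
      moreover have "?a2 \<le> C' * (?a1 / h + h powr ?p * ?T)"
      proof -
        have "sobolev_chain k s (\<lambda>j. f (Suc j))" using f by (simp add: sobolev_chain_def)
        from C'(2) [OF this h] show ?thesis by (simp add: numeral_2_eq_2)
      qed
      hence "(\<delta> * h) * ?a2 \<le> (\<delta> * h) * (C' * (?a1 / h + h powr ?p * ?T))"
        using \<delta> h by (intro mult_left_mono) auto
      hence "C * ((\<delta> * h) * ?a2) \<le> C * ((\<delta> * h) * (C' * (?a1 / h + h powr ?p * ?T)))"
        by (rule mult_left_mono) (use C(1) in simp)
      moreover have "C * ((\<delta> * h) * (C' * (?a1 / h + h powr ?p * ?T)))
          = (C * (\<delta> * C')) * (?a1 + (h * h powr ?p) * ?T)"
        using h by (simp add: field_simps)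
      moreover have "\<dots> \<le> 1 / 2 * (?a1 + (h * h powr ?p) * ?T)"
        using h \<delta>C L2_norm_nonneg [of "f 1"] top_seminorm_nonneg [of s "f (Suc k)"]
        by (intro mult_right_mono) auto
      moreover have "h * h powr ?p = h powr (real (Suc k) + s - 1)"
      proof -
        have "h * h powr ?p = h powr (1 + ?p)" using h by (subst powr_add) simp
        also have "1 + ?p = real (Suc k) + s - 1" by simp
        finally show ?thesis .
      qed
      ultimately have "?a1 \<le> C * (?a0 / (\<delta> * h)) + 1 / 2 * (?a1 + h powr (real (Suc k) + s - 1) * ?T)"
        by (simp add: distrib_left)
      moreover have "x \<le> 2 * y + z" if "x \<le> y + 1 / 2 * (x + z)" for x y z :: real
        using that by (simp add: field_simps)
      ultimately have "?a1 \<le> 2 * (C * (?a0 / (\<delta> * h))) + h powr (real (Suc k) + s - 1) * ?T"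
        by blast
      also have "2 * (C * (?a0 / (\<delta> * h))) = 2 * C / \<delta> * (?a0 / h)" by simp
      also have "2 * C / \<delta> * (?a0 / h) + h powr (real (Suc k) + s - 1) * ?T
          \<le> (2 * C / \<delta> + 1) * (?a0 / h) + (2 * C / \<delta> + 1) * (h powr (real (Suc k) + s - 1) * ?T)"
      proof (rule add_mono)
        show "2 * C / \<delta> * (?a0 / h) \<le> (2 * C / \<delta> + 1) * (?a0 / h)"
          using h L2_norm_nonneg by (intro mult_right_mono) auto
        have "1 * (h powr (real (Suc k) + s - 1) * ?T) \<le> (2 * C / \<delta> + 1) * (h powr (real (Suc k) + s - 1) * ?T)"
          using C(1) \<delta> top_seminorm_nonneg by (intro mult_right_mono) auto
        thus "h powr (real (Suc k) + s - 1) * ?T \<le> (2 * C / \<delta> + 1) * (h powr (real (Suc k) + s - 1) * ?T)"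
          by simp
      qed
      finally show "?a1 \<le> (2 * C / \<delta> + 1) * (?a0 / h + h powr (real (Suc k) + s - 1) * ?T)"
        by (simp only: distrib_left)
    qed
  qed
qed

section \<open>Choice of the scale h\<close>

text \<open>The best h makes both terms equal, which gives the factor 2C. It is admissible only for
  \<epsilon> <= M; otherwise \<open>b \<le> M\<close> is already good enough, with constant 1. If M
  or \<epsilon> is 0, the right-hand side is 0 because 0 \<open>powr\<close> anything is 0, and b <=
  0 has to be shown.\<close>

lemma optimise_scale:
  fixes r :: real
  assumes r: "r > 1" and nn: "C > 0" "\<epsilon> \<ge> 0" "M \<ge> 0" and bM: "b \<le> M"
    and b: "\<And>h. 0 < h \<Longrightarrow> h \<le> 1 \<Longrightarrow> b \<le> C * (\<epsilon> / h + h powr (r - 1) * M)"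
  shows "b \<le> (2 * C + 1) * M powr (1 / r) * \<epsilon> powr ((r - 1) / r)"
proof -
  have split: "x powr (1 / r) * x powr ((r - 1) / r) = x" if "x \<ge> 0" for x
  proof -
    have "1 / r + (r - 1) / r = 1" using r by (simp add: field_simps)
    thus ?thesis using that by (simp flip: powr_add)
  qed
  consider "M = 0" | "M > 0" "\<epsilon> = 0" | "M > 0" "\<epsilon> > M" | "0 < \<epsilon>" "\<epsilon> \<le> M"
    using nn by linarith
  thus ?thesis
  proof cases
    case 1
    thus ?thesis using bM by simp
  next
    case 2
    have "b \<le> 0"
    proof (rule ccontr)
      assume "\<not> b \<le> 0"
      hence b0: "b / (2 * (C * M)) > 0" using 2 nn by simp
      \<comment> \<open>Were b positive, this h would make C h^(r-1) M at most b/2, while the term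
        with \<epsilon> is absent.\<close>
      define h where "h = min 1 ((b / (2 * (C * M))) powr (1 / (r - 1)))"
      have h: "0 < h" "h \<le> 1" using b0 by (auto simp: h_def)
      have "h powr (r - 1) \<le> ((b / (2 * (C * M))) powr (1 / (r - 1))) powr (r - 1)"
        using r h by (intro powr_mono2) (auto simp: h_def)
      also have "\<dots> = b / (2 * (C * M))"
      proof -
        have "(y powr (1 / (r - 1))) powr (r - 1) = y" if "y > 0" for y
          using that r by (simp add: powr_powr)
        thus ?thesis using b0 .
      qed
      finally have "h powr (r - 1) * (C * M) \<le> b / (2 * (C * M)) * (C * M)"
        using 2 nn by (intro mult_right_mono) auto
      also have "\<dots> = b / 2" using 2 nn by simp
      finally have "C * (\<epsilon> / h + h powr (r - 1) * M) \<le> b / 2" using 2 by (simp add: mult_ac)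
      thus False using b [OF h] \<open>\<not> b \<le> 0\<close> by linarith
    qed
    thus ?thesis using 2 by simp
  next
    case 3
    \<comment> \<open>M is split by its exponents 1/r and (r-1)/r, and only the second factor is
      enlarged to \<epsilon>.\<close>
    have "b \<le> M powr (1 / r) * M powr ((r - 1) / r)" using bM split [of M] nn by simp
    also have "\<dots> \<le> M powr (1 / r) * \<epsilon> powr ((r - 1) / r)"
      using 3 r by (intro mult_left_mono powr_mono2) auto
    also have "\<dots> \<le> (2 * C + 1) * (M powr (1 / r) * \<epsilon> powr ((r - 1) / r))"
      using nn by (simp add: mult_right_mono [of 1 "2 * C + 1", simplified])
    finally show ?thesis by (simp add: mult.assoc)
  next
    case 4
    hence M: "M > 0" by simp
    define h where "h = \<epsilon> powr (1 / r) / M powr (1 / r)"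
    let ?P = "M powr (1 / r) * \<epsilon> powr ((r - 1) / r)"
    have h: "0 < h" "h \<le> 1" using 4 M r by (auto simp: h_def divide_le_eq powr_mono2)
    have "\<epsilon> / h = \<epsilon> powr (1 / r) * \<epsilon> powr ((r - 1) / r) / h" using split [of \<epsilon>] 4 by simp
    also have "\<dots> = ?P" using 4 M by (simp add: h_def)
    finally have 1: "\<epsilon> / h = ?P" .
    have "h powr (r - 1) = \<epsilon> powr ((r - 1) / r) / M powr ((r - 1) / r)"
      unfolding h_def using 4 M by (simp add: powr_divide powr_powr)
    hence "h powr (r - 1) * M = \<epsilon> powr ((r - 1) / r) / M powr ((r - 1) / r) * (M powr (1 / r) * M powr ((r - 1) / r))"
      using split [of M] M by simp
    hence 2: "h powr (r - 1) * M = ?P" using M by simp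
    have "b \<le> 2 * C * ?P" using b [OF h] unfolding 1 2 by simp
    also have "\<dots> \<le> (2 * C + 1) * ?P" using nn by (intro mult_right_mono) auto
    finally show ?thesis by (simp only: mult.assoc)
  qed
qed

section \<open>Change of representative, and the theorem\<close>

text \<open>Holds by completeness of Lebesgue measure: changing a function on a null set preserves
  measurability.\<close>

lemma borel_measurable_Lam_AE:
  fixes f g :: "real \<Rightarrow> real"
  assumes f: "f \<in> borel_measurable (lebesgue_on Lam)" and ae: "AE x in lebesgue_on Lam. f x = g x"
  shows "g \<in> borel_measurable (lebesgue_on Lam)"
proof (rule borel_measurable_if_D, rule borel_measurable_AE)
  show "(\<lambda>x. if x \<in> Lam then f x else 0) \<in> borel_measurable lebesgue"
    by (rule borel_measurable_if_I [OF f]) simp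
  have "AE x in lebesgue. x \<in> Lam \<longrightarrow> f x = g x"
    using ae by (subst (asm) AE_restrict_space_iff) auto
  thus "AE x in lebesgue. (if x \<in> Lam then f x else 0) = (if x \<in> Lam then g x else 0)"
    by eventually_elim simp
qed

lemma square_integrable_AE:
  assumes f: "square_integrable f" and ae: "AE x in lebesgue_on Lam. f x = g x"
  shows "square_integrable g" "L2_norm g = L2_norm f"
proof -
  note m [measurable] = square_integrableD(1) [OF f] borel_measurable_Lam_AE [OF square_integrableD(1) [OF f] ae]
  have ae2: "AE x in lebesgue_on Lam. (f x)\<^sup>2 = (g x)\<^sup>2" using ae by eventually_elim simp
  have mf: "(\<lambda>x. (f x)\<^sup>2) \<in> borel_measurable (lebesgue_on Lam)"
    and mg: "(\<lambda>x. (g x)\<^sup>2) \<in> borel_measurable (lebesgue_on Lam)" by measurable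
  show "square_integrable g"
    unfolding square_integrable_def
    using m(2) integrable_cong_AE [OF mf mg ae2] square_integrableD(2) [OF f] by blast
  show "L2_norm g = L2_norm f"
    unfolding L2_norm_def using integral_cong_AE [OF mf mg ae2] by simp
qed

lemma gtsvd_recon_poly: "\<exists>p. gtsvd_recon T m N \<eta> w U S V g = poly p"
proof (intro exI ext)
  fix x
  show "gtsvd_recon T m N \<eta> w U S V g x = poly (\<Sum>j<N. Polynomial.smult (gtsvd_coeffs m N \<eta> w U S V g $ j / sqrt T)
      (pcompose (legendre_on j) [:0, 1 / T:])) x"
    by (simp add: gtsvd_recon_def scaled_legendre_def poly_sum poly_pcompose)
qed

theorem theorem1:
  fixes r :: real
  assumes "r > 1"
  shows "\<exists>C>0. \<forall>(T::real) (m::nat) (N::nat) (\<eta>::real) (w::nat \<Rightarrow> real) (U::real mat) (S::real mat)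
            (V::real mat) (g::real \<Rightarrow> real) (q::real \<Rightarrow> real) (\<epsilon>::real) (M::real).
     T > 1 \<longrightarrow> m \<ge> 2 \<longrightarrow> N \<ge> 1 \<longrightarrow> \<eta> > 0 \<longrightarrow> (\<forall>j<N. w j > 0) \<longrightarrow>
     is_svd (sample_mat T m N * weight_inv N w) U S V \<longrightarrow>
     q = gtsvd_recon T m N \<eta> w U S V g \<longrightarrow>
     in_sobolev r (\<lambda>x. g x - q x) \<longrightarrow>
     L2_norm (\<lambda>x. g x - q x) \<le> \<epsilon> \<longrightarrow>
     sobolev_norm r (\<lambda>x. g x - q x) \<le> M \<longrightarrow>
       is_weak_deriv 1 g (weak_deriv 1 g) \<and>
       square_integrable (\<lambda>x. weak_deriv 1 g x - deriv q x) \<and>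
       L2_norm (\<lambda>x. weak_deriv 1 g x - deriv q x) \<le> C * M powr (1 / r) * \<epsilon> powr ((r - 1) / r)"
proof -
  define k where "k = nat \<lfloor>r\<rfloor>"
  define s where "s = frac r"
  have k: "k \<ge> 1" using assms unfolding k_def by linarith
  have s: "0 \<le> s" "s < 1" by (auto simp: s_def frac_lt_1)
  have r: "real k + s = r" using assms by (simp add: k_def s_def frac_def)
  obtain C where C: "C > 0" "\<And>f h. sobolev_chain k s f \<Longrightarrow> 0 < h \<Longrightarrow> h \<le> 1 \<Longrightarrow>
    L2_norm (f 1) \<le> C * (L2_norm (f 0) / h + h powr (r - 1) * top_seminorm s (f k))"
    using interpolation_chain [OF k s] assms unfolding r by blast
  show ?thesis
  proof (intro exI [of _ "2 * C + 1"] conjI allI impI)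
    show "2 * C + 1 > 0" using C(1) by simp
  next
    fix T m N \<eta> w U S V g \<epsilon> M and q :: "real \<Rightarrow> real"
    assume "q = gtsvd_recon T m N \<eta> w U S V g"
    then obtain p where p: "q = poly p" using gtsvd_recon_poly by metis
    have q: "(q has_real_derivative poly (pderiv p) x) (at x)" for x unfolding p by (rule poly_DERIV)
    have dq: "deriv q = poly (pderiv p)" using q by (auto intro!: DERIV_imp_deriv)
    have wq: "is_weak_deriv 1 q (deriv q)"
      unfolding dq by (rule is_weak_deriv_classical [OF q]) (intro continuous_intros)
    define e where "e x = g x - q x" for x
    define f where "f j = weak_deriv j e" for j
    assume "in_sobolev r (\<lambda>x. g x - q x)" and \<epsilon>: "L2_norm (\<lambda>x. g x - q x) \<le> \<epsilon>"
      and M: "sobolev_norm r (\<lambda>x. g x - q x) \<le> M"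
    hence e: "is_weak_deriv j e (f j)" "square_integrable (f j)" if "j \<le> k" for j
      using that by (auto simp: in_sobolev_def e_def [abs_def] f_def k_def)
    have chain: "sobolev_chain k s f"
      unfolding sobolev_chain_def
    proof (intro conjI allI impI)
      fix j assume "j < k"
      thus "is_weak_deriv 1 (f j) (f (Suc j))" using e(1) by (intro is_weak_deriv_step [of j e]) auto
    qed (use e \<open>in_sobolev r (\<lambda>x. g x - q x)\<close> in \<open>auto simp: in_sobolev_def e_def [abs_def] f_def k_def s_def\<close>)
    \<comment> \<open>The hypothesis bounds e itself, while the chain starts with the representative
      \<open>weak_deriv 0 e\<close>.\<close>
    have f0: "L2_norm (f 0) \<le> \<epsilon>"
      using square_integrable_AE(2) [OF e(2) weak_deriv_0_AE_eq [OF e(1)]] \<epsilon> by (simp add: e_def [abs_def])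
    define G where "G = (if s > 0 then LINT z|(lebesgue_on Lam \<Otimes>\<^sub>M lebesgue_on Lam). gagliardo_quot s (f k) z else 0)"
    have G: "G \<ge> 0" by (auto simp: G_def gagliardo_quot_def intro!: integral_nonneg_AE)
    have sob: "sqrt ((\<Sum>j\<le>k. (L2_norm (f j))\<^sup>2) + G) \<le> M"
      using M by (simp only: sobolev_norm_def G_def k_def s_def f_def e_def [abs_def])
    have le: "L2_norm (f j) \<le> M" if "j \<le> k" for j
    proof -
      have "(L2_norm (f j))\<^sup>2 \<le> (\<Sum>j\<le>k. (L2_norm (f j))\<^sup>2)" using that by (intro member_le_sum) auto
      hence "(L2_norm (f j))\<^sup>2 \<le> (\<Sum>j\<le>k. (L2_norm (f j))\<^sup>2) + G" using G by simp
      thus ?thesis using real_le_rsqrt sob by fastforce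
    qed
    have top: "top_seminorm s (f k) \<le> M"
    proof (cases "s > 0")
      case True
      have "sqrt G \<le> sqrt ((\<Sum>j\<le>k. (L2_norm (f j))\<^sup>2) + G)" by (simp add: sum_nonneg)
      hence "sqrt G \<le> M" using sob by (rule order_trans)
      thus ?thesis using True by (simp add: top_seminorm_def G_def)
    qed (use le in \<open>simp add: top_seminorm_def\<close>)
    have g: "g = (\<lambda>x. e x + q x)" by (simp add: e_def)
    \<comment> \<open>Weak differentiability of g is not assumed; it follows from that of e and the
      smoothness of the polynomial q.\<close>
    have wg: "is_weak_deriv 1 g (\<lambda>x. f 1 x + deriv q x)"
      unfolding g by (rule is_weak_deriv_add [OF e(1) [OF k] wq])
    show wd: "is_weak_deriv 1 g (weak_deriv 1 g)" unfolding weak_deriv_def by (rule someI [of "is_weak_deriv 1 g", OF wg])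
    \<comment> \<open>\<open>weak_deriv 1 g\<close> and \<open>f 1\<close> are chosen independently,
      so the estimate for \<open>f 1\<close> is transferred through uniqueness.\<close>
    have "AE x in lebesgue_on Lam. f 1 x = weak_deriv 1 g x - deriv q x"
      using weak_deriv_unique [OF wg wd] by eventually_elim simp
    note sq = square_integrable_AE [OF e(2) [OF k] this]
    show "square_integrable (\<lambda>x. weak_deriv 1 g x - deriv q x)" by (rule sq(1))
    have "L2_norm (f 1) \<le> (2 * C + 1) * M powr (1 / r) * \<epsilon> powr ((r - 1) / r)"
    proof (rule optimise_scale [OF assms C(1)])
      show "\<epsilon> \<ge> 0" "M \<ge> 0" "L2_norm (f 1) \<le> M"
        using f0 L2_norm_nonneg [of "f 0"] le [OF k] L2_norm_nonneg [of "f 1"] by auto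
      fix h :: real assume h: "0 < h" "h \<le> 1"
      have "L2_norm (f 1) \<le> C * (L2_norm (f 0) / h + h powr (r - 1) * top_seminorm s (f k))"
        by (rule C(2) [OF chain h])
      also have "\<dots> \<le> C * (\<epsilon> / h + h powr (r - 1) * M)"
        using f0 top h C(1) by (intro mult_left_mono add_mono divide_right_mono) auto
      finally show "L2_norm (f 1) \<le> C * (\<epsilon> / h + h powr (r - 1) * M)" .
    qed
    thus "L2_norm (\<lambda>x. weak_deriv 1 g x - deriv q x) \<le> (2 * C + 1) * M powr (1 / r) * \<epsilon> powr ((r - 1) / r)"
      unfolding sq(2) .
  qed
qed

end
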